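(* Let $n\ge2$. Then $W_{C_n^{(1)}}\cdot\varnothing=\mathcal C_{2n}^s$; that is, the affine Grassmannian elements of type $C_n^{(1)}$ are parametrized by the self-conjugate $2n$-cores.
   Context: A $2n$-core is a partition having no hook length equal to $2n$; $\mathcal C_{2n}$ is the set of $2n$-cores and $\mathcal C_{2n}^s=\{c\in\mathcal C_{2n}: c^{\mathrm{tr}}=c\}$ the self-conjugate ones. The box in row $i$ and column $j$ of a Young diagram has residue $(j-i)\bmod 2n$; boxes of residue $i$ are called $i$-nodes. Let $\widetilde{\mathfrak S}_{2n}$ be the affine Weyl group of type $A_{2n-1}^{(1)}$ with simple reflections $s_0,\dots,s_{2n-1}$. It acts on $\mathcal C_{2n}$: a $2n$-core never has both addable and removable $i$-nodes; $s_i\cdot c$ is obtained from $c$ by removing all removable $i$-nodes if there are some, by adding all addable $i$-nodes if there are some, and $s_i\cdot c=c$ if there are neither. The stabilizer of the empty partition $\varnothing$ is $\langle s_1,\dots,s_{2n-1}\rangle$. The affine Weyl group $W_{C_n^{(1)}}$ is realized as the subgroup of $\widetilde{\mathfrak S}_{2n}$ generated by $s_0^{C_n^{(1)}}=s_0$, $s_i^{C_n^{(1)}}=s_is_{2n-i}$ for $1\le i\le n-1$, and $s_n^{C_n^{(1)}}=s_n$. The affine Grassmannian elements of type $C_n^{(1)}$ are the minimal length representatives of the left cosets of $W_{C_n^{(1)}}$ modulo the finite Weyl group generated by $s_1^{C_n^{(1)}},\dots,s_n^{C_n^{(1)}}$; they are parametrized by cores through $w\mapsto w\cdot\varnothing$.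 *)

theory Defs
  imports "HOL-Algebra.Coset" "HOL-Algebra.Generated_Groups"
begin

section \<open>Partitions and cores\<close>

text \<open>A partition is identified with its Young diagram: a finite set of boxes
  (row, column), closed to the north-west. Rows and columns are counted from 0, which
  changes neither hook lengths nor residues. The conjugate partition is the converse
  relation, and the empty partition is the empty set.\<close>

definition young_diagram :: "(nat \<times> nat) set \<Rightarrow> bool" where
  "young_diagram D \<longleftrightarrow>
     finite D \<and> (\<forall>i j i' j'. (i, j) \<in> D \<longrightarrow> i' \<le> i \<longrightarrow> j' \<le> j \<longrightarrow> (i', j') \<in> D)"

definition hook_length :: "(nat \<times> nat) set \<Rightarrow> nat \<Rightarrow> nat \<Rightarrow> nat" where
  "hook_length D i j =
     card {j'. j < j' \<and> (i, j') \<in> D} + card {i'. i < i' \<and> (i', j) \<in> D} + 1"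

definition cores :: "nat \<Rightarrow> (nat \<times> nat) set set" where
  "cores N = {D. young_diagram D \<and> (\<forall>(i, j)\<in>D. hook_length D i j \<noteq> N)}"

definition self_conjugate_cores :: "nat \<Rightarrow> (nat \<times> nat) set set" where
  "self_conjugate_cores N = {D \<in> cores N. D\<inverse> = D}"

definition residue :: "nat \<Rightarrow> nat \<times> nat \<Rightarrow> int" where
  "residue N = (\<lambda>(i, j). (int j - int i) mod int N)"

definition addable_nodes :: "nat \<Rightarrow> nat \<Rightarrow> (nat \<times> nat) set \<Rightarrow> (nat \<times> nat) set" where
  "addable_nodes N i D = {b. b \<notin> D \<and> young_diagram (insert b D) \<and> residue N b = int i}"

definition removable_nodes :: "nat \<Rightarrow> nat \<Rightarrow> (nat \<times> nat) set \<Rightarrow> (nat \<times> nat) set" where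
  "removable_nodes N i D = {b \<in> D. young_diagram (D - {b}) \<and> residue N b = int i}"

definition reflect_core :: "nat \<Rightarrow> nat \<Rightarrow> (nat \<times> nat) set \<Rightarrow> (nat \<times> nat) set" where
  "reflect_core N i D =
     (if removable_nodes N i D \<noteq> {} then D - removable_nodes N i D
      else if addable_nodes N i D \<noteq> {} then D \<union> addable_nodes N i D
      else D)"

section \<open>The affine symmetric group and its action on cores\<close>

text \<open>The affine Weyl group of type \<open>A\<^sub>N\<^sub>-\<^sub>1\<^sup>(\<^sup>1\<^sup>)\<close> in Lusztig's realization by affine
  permutations of the integers.\<close>

definition affine_sym :: "nat \<Rightarrow> (int \<Rightarrow> int) monoid" where
  "affine_sym N =
     \<lparr>carrier = {w. bij w \<and> (\<forall>j. w (j + int N) = w j + int N) \<and>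
                    (\<Sum>j=1..int N. w j) = (\<Sum>j=1..int N. j)},
      mult = (\<circ>), one = id\<rparr>"

definition simple_refl :: "nat \<Rightarrow> nat \<Rightarrow> int \<Rightarrow> int" where
  "simple_refl N i j =
     (if j mod int N = int i mod int N then j + 1
      else if j mod int N = (int i + 1) mod int N then j - 1
      else j)"

definition word_prod :: "('a, 'b) monoid_scheme \<Rightarrow> (nat \<Rightarrow> 'a) \<Rightarrow> nat list \<Rightarrow> 'a" where
  "word_prod G s is = foldr (\<lambda>i w. s i \<otimes>\<^bsub>G\<^esub> w) is \<one>\<^bsub>G\<^esub>"

text \<open>The action extends the prescribed action of the simple reflections: write \<open>w\<close> as a
  product of simple reflections and apply these one after another, the rightmost one
  first. The resulting core does not depend on the word chosen.\<close>

definition core_act :: "nat \<Rightarrow> (int \<Rightarrow> int) \<Rightarrow> (nat \<times> nat) set \<Rightarrow> (nat \<times> nat) set" where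
  "core_act N w c =
     (THE d. \<exists>is. set is \<subseteq> {..<N} \<and> word_prod (affine_sym N) (simple_refl N) is = w \<and>
                 d = foldr (reflect_core N) is c)"

section \<open>Type C inside the affine symmetric group\<close>

definition simple_refl_C :: "nat \<Rightarrow> nat \<Rightarrow> int \<Rightarrow> int" where
  "simple_refl_C n i =
     (if i = 0 \<or> i = n then simple_refl (2 * n) i
      else simple_refl (2 * n) i \<otimes>\<^bsub>affine_sym (2 * n)\<^esub> simple_refl (2 * n) (2 * n - i))"

definition weyl_C :: "nat \<Rightarrow> (int \<Rightarrow> int) set" where
  "weyl_C n = generate (affine_sym (2 * n)) (simple_refl_C n ` {0..n})"

definition finite_weyl_C :: "nat \<Rightarrow> (int \<Rightarrow> int) set" where
  "finite_weyl_C n = generate (affine_sym (2 * n)) (simple_refl_C n ` {1..n})"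

text \<open>Coxeter length with respect to the type C generators.\<close>

definition length_C :: "nat \<Rightarrow> (int \<Rightarrow> int) \<Rightarrow> nat" where
  "length_C n w =
     (LEAST k. \<exists>is. length is = k \<and> set is \<subseteq> {0..n} \<and>
                 word_prod (affine_sym (2 * n)) (simple_refl_C n) is = w)"

definition affine_grassmannian_C :: "nat \<Rightarrow> (int \<Rightarrow> int) set" where
  "affine_grassmannian_C n =
     {w \<in> weyl_C n. \<forall>v \<in> w <#\<^bsub>affine_sym (2 * n)\<^esub> finite_weyl_C n. length_C n w \<le> length_C n v}"

end

theory Submission
  imports Defs
begin

text \<open>Encode a Young diagram by its beta-set, the set of all \<open>\<lambda>\<^sub>i - i\<close> where \<open>\<lambda>\<^sub>i\<close> is the
  length of row \<open>i\<close>, a set of integers that determines the diagram (\<open>beta_inject\<close>); the empty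
  diagram has beta-set \<open>{..0}\<close>. In this encoding everything that matters becomes a statement about
  sets of integers. The beta-set of the conjugate is the complement reflected by \<open>j \<mapsto> 1 - j\<close>
  (\<open>beta_converse\<close>). Hook lengths are the differences \<open>x - y > 0\<close> with \<open>x\<close> in the beta-set and \<open>y\<close>
  outside it, so a diagram is an \<open>N\<close>-core iff its beta-set is closed under subtracting \<open>N\<close>
  (\<open>cores_iff_beta\<close>). Adding or removing an \<open>i\<close>-node moves one element of the beta-set across the
  gap between a \<open>b\<close> congruent to \<open>i\<close> and \<open>b + 1\<close>, so the action of \<open>s\<^sub>i\<close> on cores is the
  application of the affine permutation \<open>s\<^sub>i\<close> to the beta-set (\<open>reflect_core_beta\<close>). Hence \<open>w \<cdot> \<emptyset>\<close> is
  well defined, being the core with beta-set \<open>w ` {..0}\<close>.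

  The type C generators commute with the reflection \<open>j \<mapsto> 1 - j\<close>, and so do all elements of the
  group \<open>W\<close> that they generate. As \<open>{..0}\<close> is exchanged with its complement by that reflection, so
  is \<open>w ` {..0}\<close>, which says that \<open>w \<cdot> \<emptyset>\<close> is self-conjugate. Conversely a nonempty self-conjugate
  core has a removable node of some residue \<open>i \<le> n\<close> together with the mirror-image node of residue
  \<open>-i\<close>, so that a type C generator makes it smaller (\<open>reflect_letters_shrinks\<close>), and induction on
  the number of boxes leads down to the empty core (\<open>self_conjugate_core_reached\<close>).

  For the bijection, a strong exchange argument shows that \<open>w (i + 1) < w i\<close> with \<open>1 \<le> i \<le> n\<close> makes
  \<open>w s\<^sub>i\<close> shorter than \<open>w\<close> (\<open>length_C_descent\<close>). An affine Grassmannian element is therefore increasing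
  on the window \<open>{1..2n}\<close>, where \<open>1..n\<close> is covered by the generators and the rest by symmetry. Since
  \<open>w ` {1..2n}\<close> is the difference of \<open>w ` {..0} + 2n\<close> and \<open>w ` {..0}\<close>, the core determines the
  values on the window as a set and monotonicity determines their order
  (\<open>grassmannian_determined\<close>). This gives injectivity. Surjectivity follows because the finite Weyl
  group fixes \<open>{..0}\<close>, so passing to a shortest element of a coset does not change the core.\<close>

section \<open>Beta-sets of Young diagrams\<close>

lemma young_diagram_down:
  "young_diagram D \<Longrightarrow> (i, j) \<in> D \<Longrightarrow> i' \<le> i \<Longrightarrow> j' \<le> j \<Longrightarrow> (i', j') \<in> D"
  unfolding young_diagram_def by blast

lemma young_diagramI:
  "finite D \<Longrightarrow> (\<And>i j i' j'. (i, j) \<in> D \<Longrightarrow> i' \<le> i \<Longrightarrow> j' \<le> j \<Longrightarrow> (i', j') \<in> D) \<Longrightarrow> young_diagram D"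
  unfolding young_diagram_def by blast

lemma finite_young_diagram: "young_diagram D \<Longrightarrow> finite D"
  by (simp add: young_diagram_def)

definition row_length :: "(nat \<times> nat) set \<Rightarrow> nat \<Rightarrow> nat" where
  "row_length D i = card {j. (i, j) \<in> D}"

definition bead :: "(nat \<times> nat) set \<Rightarrow> nat \<Rightarrow> int" where
  "bead D i = int (row_length D i) - int i"

definition beta :: "(nat \<times> nat) set \<Rightarrow> int set" where
  "beta D = range (bead D)"

lemma mem_iff_less_row_length:
  assumes "young_diagram D"
  shows "(i, j) \<in> D \<longleftrightarrow> j < row_length D i"
proof -
  let ?S = "{j. (i, j) \<in> D}"
  have fin: "finite ?S"
    by (rule finite_subset[of _ "snd ` D"]) (use assms in \<open>force simp: young_diagram_def\<close>)+
  have down: "j' \<in> ?S" if "j \<in> ?S" "j' \<le> j" for j j'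
    using young_diagram_down[OF assms] that by auto
  show ?thesis
  proof
    assume "(i, j) \<in> D"
    then have "{..j} \<subseteq> ?S" using down by auto
    then have "card {..j} \<le> card ?S" using fin card_mono by blast
    then show "j < row_length D i" by (simp add: row_length_def)
  next
    assume less: "j < row_length D i"
    show "(i, j) \<in> D"
    proof (rule ccontr)
      assume "(i, j) \<notin> D"
      then have "?S \<subseteq> {..<j}" using down by (auto simp: not_less[symmetric])
      then have "card ?S \<le> card {..<j}" by (intro card_mono) auto
      then show False using less by (simp add: row_length_def)
    qed
  qed
qed

lemma row_length_eqI: "row_length D i = r" if "\<And>j. (i, j) \<in> D \<longleftrightarrow> j < r"
proof -
  have "{j. (i, j) \<in> D} = {..<r}" using that by auto
  then show ?thesis by (simp add: row_length_def)
qed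

lemma row_length_antimono:
  assumes "young_diagram D" "i \<le> i'"
  shows "row_length D i' \<le> row_length D i"
proof (rule ccontr)
  assume "\<not> ?thesis"
  then have "(i', row_length D i) \<in> D"
    using mem_iff_less_row_length[OF assms(1)] by simp
  then have "(i, row_length D i) \<in> D"
    using young_diagram_down[OF assms(1)] assms(2) by blast
  then show False using mem_iff_less_row_length[OF assms(1)] by simp
qed

lemma bead_strict_antimono: "young_diagram D \<Longrightarrow> i < i' \<Longrightarrow> bead D i' < bead D i"
  using row_length_antimono[of D i i'] by (simp add: bead_def)

lemma bead_less_iff: "young_diagram D \<Longrightarrow> bead D i < bead D i' \<longleftrightarrow> i' < i"
  by (metis bead_strict_antimono less_asym linorder_neqE_nat less_irrefl)

lemma bead_eq_iff: "young_diagram D \<Longrightarrow> bead D i = bead D i' \<longleftrightarrow> i = i'"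
  by (metis bead_strict_antimono linorder_neqE_nat less_irrefl)

text \<open>Beads are listed in decreasing order, so a bead of \<open>D\<close> that is none of the first \<open>i\<close> beads of
  \<open>E\<close> is at most the next one. Used in both directions, this reads the rows off the beta-set one by one.\<close>

lemma bead_le_of_beta_subset:
  assumes "young_diagram D" "young_diagram E" "beta D \<subseteq> beta E"
    and "\<And>k. k < i \<Longrightarrow> bead D k = bead E k"
  shows "bead D i \<le> bead E i"
proof -
  obtain l where l: "bead D i = bead E l" using assms(3) by (auto simp: beta_def)
  have "\<not> l < i"
    using l assms(4)[of l] bead_eq_iff[OF assms(1), of i l] by auto
  then show ?thesis
    using l bead_less_iff[OF assms(2), of i l] by simp
qed

lemma beta_inject:
  assumes "young_diagram D" "young_diagram E" "beta D = beta E"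
  shows "D = E"
proof -
  have "bead D i = bead E i" for i
  proof (induction i rule: less_induct)
    case (less i)
    then show ?case
      using bead_le_of_beta_subset[of D E i] bead_le_of_beta_subset[of E D i] assms by force
  qed
  then have "row_length D i = row_length E i" for i by (simp add: bead_def)
  then show ?thesis
    using mem_iff_less_row_length[OF assms(1)] mem_iff_less_row_length[OF assms(2)] by auto
qed

lemma young_diagram_empty: "young_diagram {}"
  by (simp add: young_diagram_def)

lemma beta_empty: "beta {} = {..0}"
proof -
  have "x \<in> range (\<lambda>i. - int i)" if "x \<le> 0" for x :: int
    using that by (intro range_eqI[of _ _ "nat (- x)"]) simp
  then show ?thesis by (auto simp: beta_def bead_def row_length_def)
qed

section \<open>Conjugation, hook lengths and cores\<close>

lemma young_diagram_converse: "young_diagram D \<Longrightarrow> young_diagram (D\<inverse>)"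
  by (rule young_diagramI) (auto simp: finite_young_diagram intro: young_diagram_down)

text \<open>Read with \<open>x = bead D i\<close> and \<open>y = 1 - bead (D\<inverse>) j\<close>, this and the next lemma say that \<open>x - y\<close> is
  the hook length of a box inside the diagram and negative outside. In particular \<open>x\<close> and \<open>y\<close> never
  coincide.\<close>

lemma bead_sum_of_mem:
  assumes "young_diagram D" "(i, j) \<in> D"
  shows "bead D i + bead (D\<inverse>) j = int (hook_length D i j) + 1"
proof -
  note row = mem_iff_less_row_length[OF assms(1)]
  note col = mem_iff_less_row_length[OF young_diagram_converse[OF assms(1)], simplified]
  have "{j'. j < j' \<and> (i, j') \<in> D} = {j<..<row_length D i}"
    "{i'. i < i' \<and> (i', j) \<in> D} = {i<..<row_length (D\<inverse>) j}"
    using row col by auto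
  moreover have "j < row_length D i" "i < row_length (D\<inverse>) j"
    using assms(2) row col by auto
  ultimately show ?thesis by (simp add: hook_length_def bead_def)
qed

lemma bead_sum_of_not_mem:
  assumes "young_diagram D" "(i, j) \<notin> D"
  shows "bead D i + bead (D\<inverse>) j \<le> 0"
  using assms mem_iff_less_row_length[OF assms(1), of i j]
    mem_iff_less_row_length[OF young_diagram_converse[OF assms(1)], of j i]
  by (simp add: bead_def)

text \<open>Row beads and reflected column beads are disjoint by the two preceding lemmas. That every
  integer \<open>1 - m\<close> is one or the other is seen on the diagonal of content \<open>1 - m\<close>: at its first box
  outside the diagram the boundary has either a vertical step, which is the end of a row, or a horizontal
  one, which is the end of a column.\<close>

lemma beta_converse:
  assumes "young_diagram D"
  shows "m \<in> beta (D\<inverse>) \<longleftrightarrow> 1 - m \<notin> beta D"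
proof
  assume "m \<in> beta (D\<inverse>)"
  then obtain j where j: "m = bead (D\<inverse>) j" by (auto simp: beta_def)
  have "bead D i \<noteq> 1 - m" for i
    using j bead_sum_of_mem[OF assms, of i j] bead_sum_of_not_mem[OF assms, of i j]
    by (cases "(i, j) \<in> D") (auto simp: hook_length_def)
  then show "1 - m \<notin> beta D" unfolding beta_def by (metis rangeE)
next
  assume notin: "1 - m \<notin> beta D"
  \<comment> \<open>Box \<open>k\<close> of the diagonal of content \<open>1 - m\<close>; \<open>nat\<close> truncates at 0, so that the diagonal starts
    on the top or left edge.\<close>
  define r where "r k = k + nat (m - 1)" for k
  define c where "c k = k + nat (1 - m)" for k
  have diag: "int (c k) - int (r k) = 1 - m" for k by (simp add: r_def c_def)
  have "\<exists>k. (r k, c k) \<notin> D"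
  proof (rule ccontr)
    assume "\<not> ?thesis"
    then have "range (\<lambda>k. (r k, c k)) \<subseteq> D" by auto
    moreover have "inj (\<lambda>k. (r k, c k))" by (auto simp: inj_def r_def)
    ultimately have "finite (UNIV :: nat set)"
      using finite_young_diagram[OF assms] finite_imageD finite_subset by metis
    then show False by simp
  qed
  define k where "k = (LEAST k. (r k, c k) \<notin> D)"
  have k: "(r k, c k) \<notin> D"
    unfolding k_def by (rule LeastI_ex) fact
  have before: "(r k - 1, c k - 1) \<in> D" if "r k > 0" "c k > 0"
  proof -
    have "k > 0" using that by (cases k) (auto simp: r_def c_def)
    then have "(r (k - 1), c (k - 1)) \<in> D"
      using not_less_Least[of "k - 1" "\<lambda>k. (r k, c k) \<notin> D"] unfolding k_def[symmetric] by auto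
    then show ?thesis using \<open>k > 0\<close> by (simp add: r_def c_def)
  qed
  note row = mem_iff_less_row_length[OF assms]
  note col = mem_iff_less_row_length[OF young_diagram_converse[OF assms], simplified]
  have "bead D (r k) \<noteq> 1 - m" using notin unfolding beta_def by (metis rangeI)
  then have "row_length D (r k) \<noteq> c k" using diag[of k] unfolding bead_def by metis
  then have less: "row_length D (r k) < c k" using k row[of "r k" "c k"] by simp
  then have "(r k, c k - 1) \<notin> D" using row[of "r k" "c k - 1"] by simp
  then have "row_length (D\<inverse>) (c k - 1) \<le> r k" using col[of "r k" "c k - 1"] by simp
  moreover have "r k \<le> row_length (D\<inverse>) (c k - 1)"
    using before less col[of "r k - 1" "c k - 1"] by (cases "r k = 0") auto
  ultimately have "bead (D\<inverse>) (c k - 1) = m"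
    using diag[of k] less by (simp add: bead_def)
  then show "m \<in> beta (D\<inverse>)" by (auto simp: beta_def)
qed

lemma self_conjugate_iff_beta:
  assumes "young_diagram D"
  shows "D\<inverse> = D \<longleftrightarrow> (\<forall>m. m \<in> beta D \<longleftrightarrow> 1 - m \<notin> beta D)"
proof -
  have "D\<inverse> = D \<longleftrightarrow> beta (D\<inverse>) = beta D"
    using beta_inject[OF young_diagram_converse[OF assms] assms] by metis
  also have "\<dots> \<longleftrightarrow> (\<forall>m. m \<in> beta D \<longleftrightarrow> 1 - m \<notin> beta D)"
    unfolding set_eq_iff beta_converse[OF assms] by blast
  finally show ?thesis .
qed

text \<open>An \<open>x\<close> in the beta-set and \<open>y\<close> outside it with \<open>x - y = N\<close> belong to a row and a column by
  \<open>beta_converse\<close>; they meet in a box of the diagram because \<open>x > y\<close>, and the hook length there is \<open>N\<close>.\<close>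

lemma cores_iff_beta:
  assumes "N > 0"
  shows "D \<in> cores N \<longleftrightarrow> young_diagram D \<and> (\<forall>b\<in>beta D. b - int N \<in> beta D)"
proof (cases "young_diagram D")
  case True
  have "(\<forall>(i, j)\<in>D. hook_length D i j \<noteq> N) \<longleftrightarrow> (\<forall>b\<in>beta D. b - int N \<in> beta D)"
  proof
    assume core: "\<forall>(i, j)\<in>D. hook_length D i j \<noteq> N"
    show "\<forall>b\<in>beta D. b - int N \<in> beta D"
    proof (rule ballI, rule ccontr)
      fix b assume b: "b \<in> beta D" "b - int N \<notin> beta D"
      then have "1 - (b - int N) \<in> beta (D\<inverse>)" using beta_converse[OF True] by simp
      then obtain i j where ij: "b = bead D i" "1 - (b - int N) = bead (D\<inverse>) j"
        using b by (auto simp: beta_def)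
      then have sum: "bead D i + bead (D\<inverse>) j = int N + 1" by simp
      then have mem: "(i, j) \<in> D" using bead_sum_of_not_mem[OF True, of i j] by force
      then have "hook_length D i j = N" using bead_sum_of_mem[OF True mem] sum by simp
      then show False using core mem by auto
    qed
  next
    assume closed: "\<forall>b\<in>beta D. b - int N \<in> beta D"
    have "hook_length D i j \<noteq> N" if "(i, j) \<in> D" for i j
    proof
      assume "hook_length D i j = N"
      then have "1 - bead (D\<inverse>) j = bead D i - int N"
        using bead_sum_of_mem[OF True that] by simp
      moreover have "bead D i - int N \<in> beta D" using closed by (simp add: beta_def)
      moreover have "bead (D\<inverse>) j \<in> beta (D\<inverse>)" by (simp add: beta_def)
      ultimately show False using beta_converse[OF True] by metis
    qed
    then show "\<forall>(i, j)\<in>D. hook_length D i j \<noteq> N" by auto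
  qed
  then show ?thesis using True by (simp add: cores_def)
qed (simp add: cores_def)

section \<open>Adding and removing nodes\<close>

text \<open>A box can be removed iff it ends its row and the next row is shorter; the latter says
  exactly that the bead of the row can move down by one to a free place.\<close>

lemma young_diagram_Diff_iff:
  assumes "young_diagram D" "(p, q) \<in> D"
  shows "young_diagram (D - {(p, q)}) \<longleftrightarrow> int q = bead D p - 1 + int p \<and> bead D p - 1 \<notin> beta D"
proof -
  note row = mem_iff_less_row_length[OF assms(1)]
  have q: "q < row_length D p" using assms(2) row by simp
  have beta: "bead D p - 1 \<in> beta D \<longleftrightarrow> row_length D (Suc p) = row_length D p"
  proof
    assume "bead D p - 1 \<in> beta D"
    then obtain l where l: "bead D p - 1 = bead D l" by (auto simp: beta_def)
    then have "p < l" using bead_less_iff[OF assms(1), of l p] by simp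
    then have "\<not> Suc p < l"
      using l bead_strict_antimono[OF assms(1), of p "Suc p"]
        bead_strict_antimono[OF assms(1), of "Suc p" l] by auto
    then have "l = Suc p" using \<open>p < l\<close> by simp
    then show "row_length D (Suc p) = row_length D p" using l by (simp add: bead_def)
  next
    assume "row_length D (Suc p) = row_length D p"
    then have "bead D p - 1 = bead D (Suc p)" by (simp add: bead_def)
    then show "bead D p - 1 \<in> beta D" by (simp add: beta_def)
  qed
  have le: "row_length D (Suc p) \<le> row_length D p"
    using row_length_antimono[OF assms(1)] by simp
  have "young_diagram (D - {(p, q)}) \<longleftrightarrow> (p, Suc q) \<notin> D \<and> (Suc p, q) \<notin> D"
  proof
    assume "young_diagram (D - {(p, q)})"
    then have "(i, j) \<in> D \<Longrightarrow> (i, j) \<noteq> (p, q) \<Longrightarrow> p \<le> i \<Longrightarrow> \<not> q \<le> j" for i j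
      using young_diagram_down[of "D - {(p, q)}" i j p q] by blast
    from this[of p "Suc q"] this[of "Suc p" q]
    show "(p, Suc q) \<notin> D \<and> (Suc p, q) \<notin> D" by auto
  next
    assume *: "(p, Suc q) \<notin> D \<and> (Suc p, q) \<notin> D"
    have "(i, j) \<notin> D" if "p \<le> i" "q \<le> j" "(i, j) \<noteq> (p, q)" for i j
    proof
      assume "(i, j) \<in> D"
      moreover have "Suc p \<le> i \<or> Suc q \<le> j" using that by auto
      ultimately show False using * that young_diagram_down[OF assms(1)] by metis
    qed
    then show "young_diagram (D - {(p, q)})"
      using young_diagram_down[OF assms(1)] finite_young_diagram[OF assms(1)]
      by (intro young_diagramI) blast+
  qed
  also have "\<dots> \<longleftrightarrow> int q = bead D p - 1 + int p \<and> bead D p - 1 \<notin> beta D"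
    unfolding beta using row[of p "Suc q"] row[of "Suc p" q] q le by (auto simp: bead_def)
  finally show ?thesis .
qed

text \<open>The dual of \<open>young_diagram_Diff_iff\<close>: the box right after the end of a row can be added iff the
  row above is longer, that is, iff the bead of the row can move up by one. The content of the
  new box is the old position of the bead.\<close>

lemma young_diagram_insert_iff:
  assumes "young_diagram D" "(p, q) \<notin> D"
  shows "young_diagram (insert (p, q) D) \<longleftrightarrow> int q = bead D p + int p \<and> bead D p + 1 \<notin> beta D"
proof -
  note row = mem_iff_less_row_length[OF assms(1)]
  have q: "row_length D p \<le> q" using assms(2) row[of p q] by simp
  have beta: "bead D p + 1 \<in> beta D \<longleftrightarrow> p > 0 \<and> row_length D (p - 1) = row_length D p"
  proof
    assume "bead D p + 1 \<in> beta D"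
    then obtain l where l: "bead D p + 1 = bead D l" by (auto simp: beta_def)
    then have "l < p" using bead_less_iff[OF assms(1), of p l] by simp
    then have "\<not> l < p - 1"
      using l bead_strict_antimono[OF assms(1), of "p - 1" p]
        bead_strict_antimono[OF assms(1), of l "p - 1"] by auto
    then have "l = p - 1" using \<open>l < p\<close> by simp
    then show "p > 0 \<and> row_length D (p - 1) = row_length D p"
      using l \<open>l < p\<close> by (simp add: bead_def)
  next
    assume "p > 0 \<and> row_length D (p - 1) = row_length D p"
    then have "bead D p + 1 = bead D (p - 1)" by (simp add: bead_def)
    then show "bead D p + 1 \<in> beta D" by (simp add: beta_def)
  qed
  have le: "row_length D p \<le> row_length D (p - 1)"
    using row_length_antimono[OF assms(1)] by simp
  have "young_diagram (insert (p, q) D) \<longleftrightarrow>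
      (q > 0 \<longrightarrow> (p, q - 1) \<in> D) \<and> (p > 0 \<longrightarrow> (p - 1, q) \<in> D)"
  proof
    assume "young_diagram (insert (p, q) D)"
    then have "i \<le> p \<Longrightarrow> j \<le> q \<Longrightarrow> (i, j) \<in> insert (p, q) D" for i j
      using young_diagram_down[of "insert (p, q) D" p q i j] by blast
    from this[of p "q - 1"] this[of "p - 1" q]
    show "(q > 0 \<longrightarrow> (p, q - 1) \<in> D) \<and> (p > 0 \<longrightarrow> (p - 1, q) \<in> D)" by auto
  next
    assume *: "(q > 0 \<longrightarrow> (p, q - 1) \<in> D) \<and> (p > 0 \<longrightarrow> (p - 1, q) \<in> D)"
    have "(i, j) \<in> D" if "i \<le> p" "j \<le> q" "(i, j) \<noteq> (p, q)" for i j
    proof -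
      have "(q > 0 \<and> j \<le> q - 1) \<or> (p > 0 \<and> i \<le> p - 1)" using that by auto
      then show ?thesis using * that young_diagram_down[OF assms(1)] by metis
    qed
    then show "young_diagram (insert (p, q) D)"
      using young_diagram_down[OF assms(1)] finite_young_diagram[OF assms(1)]
      by (intro young_diagramI) blast+
  qed
  also have "\<dots> \<longleftrightarrow> int q = bead D p + int p \<and> bead D p + 1 \<notin> beta D"
    unfolding beta using row[of p "q - 1"] row[of "p - 1" q] q le by (auto simp: bead_def)
  finally show ?thesis .
qed

lemma row_length_pos_of_gap:
  assumes "young_diagram D" "bead D p - 1 \<notin> beta D"
  shows "row_length D p > 0"
proof (rule ccontr)
  assume "\<not> ?thesis"
  then have "bead D p - 1 = bead D (Suc p)"
    using row_length_antimono[OF assms(1), of p "Suc p"] by (simp add: bead_def)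
  then show False using assms(2) by (simp add: beta_def)
qed

lemma removable_nodes_iff:
  assumes "young_diagram D" "i < N"
  shows "(p, q) \<in> removable_nodes N i D \<longleftrightarrow>
    int q = bead D p - 1 + int p \<and> bead D p - 1 \<notin> beta D \<and> (bead D p - 1) mod int N = int i"
proof -
  have "(p, q) \<in> D" if "int q = bead D p - 1 + int p"
    using that mem_iff_less_row_length[OF assms(1)] by (simp add: bead_def)
  then show ?thesis
    using young_diagram_Diff_iff[OF assms(1), of p q]
    by (auto simp: removable_nodes_def residue_def)
qed

lemma addable_nodes_iff:
  assumes "young_diagram D" "i < N"
  shows "(p, q) \<in> addable_nodes N i D \<longleftrightarrow>
    int q = bead D p + int p \<and> bead D p + 1 \<notin> beta D \<and> bead D p mod int N = int i"
proof -
  have "(p, q) \<notin> D" if "int q = bead D p + int p"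
    using that mem_iff_less_row_length[OF assms(1)] by (simp add: bead_def)
  then show ?thesis
    using young_diagram_insert_iff[OF assms(1), of p q]
    by (auto simp: addable_nodes_def residue_def)
qed

lemma removable_nodes_nonempty_iff:
  assumes "young_diagram D" "i < N"
  shows "removable_nodes N i D \<noteq> {} \<longleftrightarrow>
    (\<exists>b\<in>beta D. b - 1 \<notin> beta D \<and> (b - 1) mod int N = int i)"
proof
  assume "removable_nodes N i D \<noteq> {}"
  then show "\<exists>b\<in>beta D. b - 1 \<notin> beta D \<and> (b - 1) mod int N = int i"
    using removable_nodes_iff[OF assms] by (fastforce simp: beta_def)
next
  assume "\<exists>b\<in>beta D. b - 1 \<notin> beta D \<and> (b - 1) mod int N = int i"
  then obtain p where p: "bead D p - 1 \<notin> beta D" "(bead D p - 1) mod int N = int i"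
    by (auto simp: beta_def)
  have "row_length D p > 0" using row_length_pos_of_gap[OF assms(1) p(1)] .
  then have "(p, row_length D p - 1) \<in> removable_nodes N i D"
    using removable_nodes_iff[OF assms] p by (simp add: bead_def)
  then show "removable_nodes N i D \<noteq> {}" by auto
qed

lemma addable_nodes_nonempty_iff:
  assumes "young_diagram D" "i < N"
  shows "addable_nodes N i D \<noteq> {} \<longleftrightarrow>
    (\<exists>b\<in>beta D. b + 1 \<notin> beta D \<and> b mod int N = int i)"
proof
  assume "addable_nodes N i D \<noteq> {}"
  then show "\<exists>b\<in>beta D. b + 1 \<notin> beta D \<and> b mod int N = int i"
    using addable_nodes_iff[OF assms] by (fastforce simp: beta_def)
next
  assume "\<exists>b\<in>beta D. b + 1 \<notin> beta D \<and> b mod int N = int i"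
  then obtain p where p: "bead D p + 1 \<notin> beta D" "bead D p mod int N = int i"
    by (auto simp: beta_def)
  then have "(p, row_length D p) \<in> addable_nodes N i D"
    using addable_nodes_iff[OF assms] by (simp add: bead_def)
  then show "addable_nodes N i D \<noteq> {}" by auto
qed

lemma young_diagram_remove:
  assumes "young_diagram D"
  shows "young_diagram (D - removable_nodes N i D)"
proof (rule young_diagramI)
  fix p q p' q'
  assume mem: "(p, q) \<in> D - removable_nodes N i D" and le: "p' \<le> p" "q' \<le> q"
  have "(p', q') \<notin> removable_nodes N i D"
  proof
    assume rem: "(p', q') \<in> removable_nodes N i D"
    then have young: "young_diagram (D - {(p', q')})" by (simp add: removable_nodes_def)
    have "(p, q) \<in> D - {(p', q')}" using mem rem by auto
    then show False using young_diagram_down[OF young _ le] by blast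
  qed
  then show "(p', q') \<in> D - removable_nodes N i D"
    using mem le young_diagram_down[OF assms] by blast
qed (simp add: finite_young_diagram[OF assms])

text \<open>An addable node lies in the first row or directly below a box of the diagram.\<close>

lemma finite_addable_nodes:
  assumes "young_diagram D" "i < N"
  shows "finite (addable_nodes N i D)"
proof (rule finite_subset)
  show "addable_nodes N i D \<subseteq>
    insert (0, row_length D 0) ((\<lambda>(p, q). (Suc p, q)) ` D)"
  proof
    fix b assume b: "b \<in> addable_nodes N i D"
    obtain p q where pq: "b = (p, q)" by (cases b)
    show "b \<in> insert (0, row_length D 0) ((\<lambda>(p, q). (Suc p, q)) ` D)"
    proof (cases p)
      case 0
      then show ?thesis
        using b pq addable_nodes_iff[OF assms, of p q] by (simp add: bead_def)
    next
      case (Suc p')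
      have "young_diagram (insert (p, q) D)" using b pq by (simp add: addable_nodes_def)
      from young_diagram_down[OF this, of p q p' q] have "(p', q) \<in> D" using Suc by simp
      then show ?thesis using pq Suc by force
    qed
  qed
qed (simp add: finite_young_diagram[OF assms(1)])

lemma young_diagram_add:
  assumes "young_diagram D" "i < N"
  shows "young_diagram (D \<union> addable_nodes N i D)"
proof (rule young_diagramI)
  fix p q p' q'
  assume mem: "(p, q) \<in> D \<union> addable_nodes N i D" and le: "p' \<le> p" "q' \<le> q"
  show "(p', q') \<in> D \<union> addable_nodes N i D"
  proof (cases "(p, q) \<in> D")
    case True
    then show ?thesis using young_diagram_down[OF assms(1) _ le] by blast
  next
    case False
    then have "(p, q) \<in> addable_nodes N i D" using mem by simp
    then have young: "young_diagram (insert (p, q) D)" by (simp add: addable_nodes_def)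
    then have "(p', q') \<in> insert (p, q) D" using young_diagram_down[OF young _ le] by blast
    then show ?thesis using mem by blast
  qed
qed (simp add: finite_young_diagram[OF assms(1)] finite_addable_nodes[OF assms])

lemma bead_remove:
  assumes "young_diagram D" "i < N"
  shows "bead (D - removable_nodes N i D) p =
    (if bead D p - 1 \<notin> beta D \<and> (bead D p - 1) mod int N = int i then bead D p - 1 else bead D p)"
proof -
  note row = mem_iff_less_row_length[OF assms(1)]
  note rem = removable_nodes_iff[OF assms]
  show ?thesis
  proof (cases "bead D p - 1 \<notin> beta D \<and> (bead D p - 1) mod int N = int i")
    case True
    have "row_length D p > 0" using row_length_pos_of_gap[OF assms(1)] True by blast
    moreover have "row_length (D - removable_nodes N i D) p = row_length D p - 1"
      using True row rem by (intro row_length_eqI) (auto simp: bead_def)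
    ultimately show ?thesis using True by (simp add: bead_def)
  next
    case False
    have "row_length (D - removable_nodes N i D) p = row_length D p"
      using False row rem by (intro row_length_eqI) auto
    then show ?thesis using False by (auto simp: bead_def)
  qed
qed

lemma bead_add:
  assumes "young_diagram D" "i < N"
  shows "bead (D \<union> addable_nodes N i D) p =
    (if bead D p + 1 \<notin> beta D \<and> bead D p mod int N = int i then bead D p + 1 else bead D p)"
proof -
  note row = mem_iff_less_row_length[OF assms(1)]
  note add = addable_nodes_iff[OF assms]
  show ?thesis
  proof (cases "bead D p + 1 \<notin> beta D \<and> bead D p mod int N = int i")
    case True
    have "row_length (D \<union> addable_nodes N i D) p = row_length D p + 1"
      using True row add by (intro row_length_eqI) (auto simp: bead_def)
    then show ?thesis using True by (simp add: bead_def)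
  next
    case False
    have "row_length (D \<union> addable_nodes N i D) p = row_length D p"
      using False row add by (intro row_length_eqI) auto
    then show ?thesis using False by (auto simp: bead_def)
  qed
qed

section \<open>Reflections act on beta-sets\<close>

lemma simple_refl_dvd:
  "simple_refl N i j =
    (if int N dvd j - int i then j + 1 else if int N dvd j - int i - 1 then j - 1 else j)"
  by (simp add: simple_refl_def mod_eq_dvd_iff algebra_simps)

lemma mod_eq_iff_dvd_diff: "i < N \<Longrightarrow> b mod int N = int i \<longleftrightarrow> int N dvd b - int i"
  by (metis mod_eq_dvd_iff mod_pos_pos_trivial of_nat_0_le_iff of_nat_less_iff)

lemma simple_refl_shift: "simple_refl N i (j + int N) = simple_refl N i j + int N"
proof -
  have "int N dvd j + int N - int i \<longleftrightarrow> int N dvd j - int i"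
    "int N dvd j + int N - int i - 1 \<longleftrightarrow> int N dvd j - int i - 1"
    by (metis add_diff_eq diff_add_eq dvd_add_triv_right_iff)+
  then show ?thesis by (simp add: simple_refl_dvd)
qed

lemma not_dvd_succ: "2 \<le> N \<Longrightarrow> int N dvd j \<Longrightarrow> \<not> int N dvd j + 1"
  using zdvd1_eq[of "int N"] dvd_add_right_iff[of "int N" j 1] by auto

lemma simple_refl_involution: "2 \<le> N \<Longrightarrow> simple_refl N i (simple_refl N i j) = j"
  using not_dvd_succ[of N "j - int i"] not_dvd_succ[of N "j - int i - 1"]
  by (auto simp: simple_refl_dvd algebra_simps)

text \<open>An upward move of \<open>b\<close> and a downward move of \<open>c\<close> belong to the same residue iff \<open>b + 1 \<equiv> c\<close>
  modulo \<open>N\<close>. Whichever of \<open>b + 1\<close> and \<open>c\<close> is larger, closure under subtracting \<open>N\<close> fills one of the two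
  places that should be free.\<close>

lemma core_not_addable_and_removable:
  assumes closed: "\<forall>b\<in>B. b - int N \<in> B" and "N > 0"
    and b: "b \<in> B" "b + 1 \<notin> B" and c: "c \<in> B" "c - 1 \<notin> B"
  shows "\<not> int N dvd c - 1 - b"
proof
  have shift: "x - int N * int k \<in> B" if "x \<in> B" for x k
  proof (induction k)
    case (Suc k)
    then show ?case using closed by (fastforce simp: algebra_simps)
  qed (simp add: that)
  assume "int N dvd c - 1 - b"
  then obtain k where k: "c - 1 - b = int N * k" by blast
  show False
  proof (cases "k \<ge> 0")
    case True
    then have "b + 1 = c - int N * int (nat k)" using k by simp
    then show False using shift[OF c(1)] b by metis
  next
    case False
    then have "c - 1 = b - int N * int (nat (- k))" using k by (simp add: algebra_simps)
    then show False using shift[OF b(1)] c by metis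
  qed
qed

text \<open>Removing nodes moves every bead that can move down, and leaves a bead \<open>b\<close> with \<open>b - 1\<close>
  occupied where it is; as a set, such a pair of neighbours is also unchanged when \<open>s\<^sub>i\<close> exchanges its two
  elements. What makes the image under \<open>s\<^sub>i\<close> right is that no bead of the class concerned can
  move in the other direction, which holds for cores.\<close>

lemma reflect_core_beta:
  assumes N: "2 \<le> N" and D: "D \<in> cores N" and i: "i < N"
  shows "young_diagram (reflect_core N i D)"
    and "beta (reflect_core N i D) = simple_refl N i ` beta D"
proof -
  have young: "young_diagram D" and closed: "\<forall>b\<in>beta D. b - int N \<in> beta D"
    using D N cores_iff_beta[of N D] by auto
  show "young_diagram (reflect_core N i D)"
    unfolding reflect_core_def
    using young young_diagram_remove young_diagram_add[OF young i] by auto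
  let ?s = "simple_refl N i"
  have image: "x \<in> ?s ` B \<longleftrightarrow> ?s x \<in> B" for x B
  proof
    assume "?s x \<in> B"
    then show "x \<in> ?s ` B"
      using simple_refl_involution[OF N, of i x] by (intro image_eqI[of _ _ "?s x"]) auto
  qed (auto simp: simple_refl_involution[OF N])
  define P where "P x \<longleftrightarrow> int N dvd x - int i" for x
  have P_mod: "x mod int N = int i \<longleftrightarrow> P x" for x
    using mod_eq_iff_dvd_diff[OF i] by (simp add: P_def)
  have P_pred: "\<not> P (x - 1)" if "P x" for x
    using not_dvd_succ[OF N, of "x - 1 - int i"] that by (auto simp: P_def algebra_simps)
  have s_eq: "?s x = (if P x then x + 1 else if P (x - 1) then x - 1 else x)" for x
    by (simp add: simple_refl_dvd P_def algebra_simps)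
  let ?R = "removable_nodes N i D" and ?A = "addable_nodes N i D"
  have R: "?R \<noteq> {} \<longleftrightarrow> (\<exists>b\<in>beta D. b - 1 \<notin> beta D \<and> P (b - 1))"
    using removable_nodes_nonempty_iff[OF young i] by (simp add: P_mod)
  have A: "?A \<noteq> {} \<longleftrightarrow> (\<exists>b\<in>beta D. b + 1 \<notin> beta D \<and> P b)"
    using addable_nodes_nonempty_iff[OF young i] by (simp add: P_mod)
  have excl: "?R = {} \<or> ?A = {}"
  proof (rule ccontr)
    assume "\<not> ?thesis"
    then obtain b c where b: "b \<in> beta D" "b + 1 \<notin> beta D" "P b"
      and c: "c \<in> beta D" "c - 1 \<notin> beta D" "P (c - 1)" using R A by auto
    have "int N dvd (c - 1 - int i) - (b - int i)"
      using b(3) c(3) unfolding P_def by (simp only: dvd_diff)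
    also have "(c - 1 - int i) - (b - int i) = c - 1 - b" by simp
    finally show False
      using core_not_addable_and_removable[OF closed _ b(1,2) c(1,2)] N by simp
  qed
  have "x \<in> beta (reflect_core N i D) \<longleftrightarrow> ?s x \<in> beta D" for x
  proof (cases "?R = {}")
    case False
    then have up: "x + 1 \<in> beta D" if "x \<in> beta D" "P x" for x
      using excl A that by auto
    have "x \<in> beta (reflect_core N i D) \<longleftrightarrow>
      (\<exists>p. x = (if bead D p - 1 \<notin> beta D \<and> P (bead D p - 1) then bead D p - 1 else bead D p))"
      using False by (auto simp: reflect_core_def beta_def[of "D - ?R"]
          bead_remove[OF young i] P_mod)
    also have "\<dots> \<longleftrightarrow>
      (\<exists>b\<in>beta D. x = (if b - 1 \<notin> beta D \<and> P (b - 1) then b - 1 else b))"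
      unfolding beta_def by blast
    also have "\<dots> \<longleftrightarrow> (x \<in> beta D \<and> \<not> (x - 1 \<notin> beta D \<and> P (x - 1))) \<or>
      (x + 1 \<in> beta D \<and> x \<notin> beta D \<and> P x)"
      by (auto split: if_splits intro: bexI[of _ "x + 1"] bexI[of _ x])
    also have "\<dots> \<longleftrightarrow> ?s x \<in> beta D"
      using up[of x] up[of "x - 1"] P_pred[of x] by (auto simp: s_eq)
    finally show ?thesis .
  next
    case True
    then have down: "x - 1 \<in> beta D" if "x \<in> beta D" "P (x - 1)" for x
      using R that by auto
    show ?thesis
    proof (cases "?A = {}")
      case False
      have "x \<in> beta (reflect_core N i D) \<longleftrightarrow>
        (\<exists>p. x = (if bead D p + 1 \<notin> beta D \<and> P (bead D p) then bead D p + 1 else bead D p))"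
        using True False by (auto simp: reflect_core_def beta_def[of "D \<union> ?A"]
            bead_add[OF young i] P_mod)
      also have "\<dots> \<longleftrightarrow>
        (\<exists>b\<in>beta D. x = (if b + 1 \<notin> beta D \<and> P b then b + 1 else b))"
        unfolding beta_def by blast
      also have "\<dots> \<longleftrightarrow> (x \<in> beta D \<and> \<not> (x + 1 \<notin> beta D \<and> P x)) \<or>
        (x - 1 \<in> beta D \<and> x \<notin> beta D \<and> P (x - 1))"
        by (auto split: if_splits intro: bexI[of _ "x - 1"] bexI[of _ x])
      also have "\<dots> \<longleftrightarrow> ?s x \<in> beta D"
        using down[of x] down[of "x + 1"] P_pred[of x] by (auto simp: s_eq)
      finally show ?thesis .
    next
      case empty: True
      then have up: "x + 1 \<in> beta D" if "x \<in> beta D" "P x" for x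
        using A that by auto
      have stay: "y + 1 \<in> beta D \<longleftrightarrow> y \<in> beta D" if "P y" for y
        using up[of y] down[of "y + 1"] that by auto
      have "?s x \<in> beta D \<longleftrightarrow> x \<in> beta D"
        using stay[of x] stay[of "x - 1"] by (simp add: s_eq)
      moreover have "reflect_core N i D = D" using True empty by (simp add: reflect_core_def)
      ultimately show ?thesis by simp
    qed
  qed
  then show "beta (reflect_core N i D) = ?s ` beta D" using image by blast
qed

lemma foldr_reflect_core:
  assumes "2 \<le> N" "set is \<subseteq> {..<N}" "c \<in> cores N"
  shows "foldr (reflect_core N) is c \<in> cores N"
    and "beta (foldr (reflect_core N) is c) = word_prod (affine_sym N) (simple_refl N) is ` beta c"
  using assms(2)
proof (induction "is")
  case Nil
  case 1 show ?case using assms by simp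
  case 2 show ?case by (simp add: word_prod_def affine_sym_def)
next
  case (Cons i "is")
  let ?d = "foldr (reflect_core N) is c"
  case 1
  then have i: "i < N" and d: "?d \<in> cores N" using Cons.IH(1) by auto
  have "b - int N \<in> simple_refl N i ` beta ?d" if b: "b \<in> simple_refl N i ` beta ?d" for b
  proof -
    obtain a where a: "b = simple_refl N i a" "a \<in> beta ?d" using b by blast
    have "a - int N \<in> beta ?d" using d a assms(1) cores_iff_beta[of N ?d] by auto
    moreover have "b - int N = simple_refl N i (a - int N)"
      using simple_refl_shift[of N i "a - int N"] a by simp
    ultimately show ?thesis by blast
  qed
  then show ?case
    using reflect_core_beta[OF assms(1) d i] assms(1)
      cores_iff_beta[of N "reflect_core N i ?d"] by simp
  case 2
  then have i: "i < N" and d: "?d \<in> cores N" using Cons.IH(1) by auto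
  have "beta ?d = word_prod (affine_sym N) (simple_refl N) is ` beta c"
    using Cons.IH(2) 2 by simp
  then show ?case
    using reflect_core_beta(2)[OF assms(1) d i]
    by (simp add: word_prod_def affine_sym_def image_comp)
qed

text \<open>Two words with the same product lead to cores with the same beta-set, hence to the same core;
  this is the independence of the chosen word on which the definition of the action by a
  definite description rests.\<close>

lemma core_act_word:
  assumes "2 \<le> N" "set is \<subseteq> {..<N}" "c \<in> cores N"
  shows "core_act N (word_prod (affine_sym N) (simple_refl N) is) c = foldr (reflect_core N) is c"
  unfolding core_act_def
proof (rule the_equality)
  show "\<exists>js. set js \<subseteq> {..<N} \<and>
      word_prod (affine_sym N) (simple_refl N) js = word_prod (affine_sym N) (simple_refl N) is \<and>
      foldr (reflect_core N) is c = foldr (reflect_core N) js c"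
    using assms(2) by (intro exI[of _ "is"]) simp
next
  fix d assume "\<exists>js. set js \<subseteq> {..<N} \<and>
      word_prod (affine_sym N) (simple_refl N) js = word_prod (affine_sym N) (simple_refl N) is \<and>
      d = foldr (reflect_core N) js c"
  then obtain js where js: "set js \<subseteq> {..<N} \<and>
      word_prod (affine_sym N) (simple_refl N) js = word_prod (affine_sym N) (simple_refl N) is \<and>
      d = foldr (reflect_core N) js c" ..
  have "young_diagram (foldr (reflect_core N) ks c)" if "set ks \<subseteq> {..<N}" for ks
    using foldr_reflect_core(1)[OF assms(1) that assms(3)] by (simp add: cores_def)
  then show "d = foldr (reflect_core N) is c"
    using foldr_reflect_core(2)[OF assms] foldr_reflect_core(2)[OF assms(1) _ assms(3), of js]
      js assms(2) by (intro beta_inject) simp_all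
qed

section \<open>The Weyl group of type C as symmetric affine permutations\<close>

text \<open>The generator \<open>s\<^sub>m\<close> of type C exchanges \<open>j\<close> and \<open>j + 1\<close> for every \<open>j\<close> congruent to \<open>m\<close> or \<open>-m\<close>.
  Defining this for all integers \<open>m\<close>, instead of the indices \<open>0..n\<close> only, treats the three shapes
  of generators alike and gives a name to every conjugate that occurs in \<open>refl_C_conjugate\<close>.\<close>

definition wall :: "nat \<Rightarrow> int \<Rightarrow> int \<Rightarrow> bool" where
  "wall n m j \<longleftrightarrow> int (2 * n) dvd j - m \<or> int (2 * n) dvd j + m"

definition refl_C :: "nat \<Rightarrow> int \<Rightarrow> int \<Rightarrow> int" where
  "refl_C n m j = (if wall n m j then j + 1 else if wall n m (j - 1) then j - 1 else j)"

text \<open>As the period \<open>2n\<close> is even and \<open>m\<close>, \<open>-m\<close> have the same parity, two neighbouring integers are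
  never both walls; this is why the exchanged pairs of \<open>refl_C\<close> do not overlap.\<close>

lemma wall_even: "wall n m j \<Longrightarrow> even (j - m)"
proof -
  have "even (int (2 * n))" by simp
  moreover assume "wall n m j"
  ultimately have "even (j - m) \<or> even (j + m)" unfolding wall_def using dvd_trans by blast
  then show "even (j - m)" by simp
qed

lemma wall_pred: "wall n m j \<Longrightarrow> \<not> wall n m (j - 1)"
  using wall_even[of n m j] wall_even[of n m "j - 1"] by auto

lemma wall_uminus: "wall n m (- j) \<longleftrightarrow> wall n m j"
proof -
  have "int (2 * n) dvd - j - m \<longleftrightarrow> int (2 * n) dvd j + m"
    using dvd_minus_iff[of "int (2 * n)" "j + m"] by simp
  moreover have "int (2 * n) dvd - j + m \<longleftrightarrow> int (2 * n) dvd j - m"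
    using dvd_minus_iff[of "int (2 * n)" "j - m"] by simp
  ultimately show ?thesis unfolding wall_def by blast
qed

lemma wall_shift: "wall n m (j + int (2 * n)) \<longleftrightarrow> wall n m j"
proof -
  have "int (2 * n) dvd j + int (2 * n) - m \<longleftrightarrow> int (2 * n) dvd j - m"
    "int (2 * n) dvd j + int (2 * n) + m \<longleftrightarrow> int (2 * n) dvd j + m"
    using dvd_add_triv_right_iff[of "int (2 * n)" "j - m"]
      dvd_add_triv_right_iff[of "int (2 * n)" "j + m"] by (simp_all add: algebra_simps)
  then show ?thesis unfolding wall_def by blast
qed

lemma wall_base_change:
  assumes "wall n m p"
  shows "wall n m = wall n p"
proof
  fix j
  have eq: "int (2 * n) dvd j - m \<longleftrightarrow> int (2 * n) dvd j - p"
    "int (2 * n) dvd j + m \<longleftrightarrow> int (2 * n) dvd j + p" if "int (2 * n) dvd p - m"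
    using dvd_add_left_iff[OF that, of "j - p"] dvd_add_left_iff[OF that, of "j + m"]
    by (simp_all add: algebra_simps)
  have eq': "int (2 * n) dvd j - m \<longleftrightarrow> int (2 * n) dvd j + p"
    "int (2 * n) dvd j + m \<longleftrightarrow> int (2 * n) dvd j - p" if "int (2 * n) dvd p + m"
    using dvd_add_left_iff[OF that, of "j - m"] dvd_add_left_iff[OF that, of "j - p"]
    by (simp_all add: algebra_simps)
  show "wall n m j = wall n p j"
    using assms eq eq' unfolding wall_def by blast
qed

lemma refl_C_involution: "refl_C n m (refl_C n m j) = j"
  using wall_pred[of n m j] wall_pred[of n m "j - 1"] wall_pred[of n m "j + 1"]
  by (auto simp: refl_C_def)

lemma simple_refl_C_eq:
  assumes "0 < n" "i \<le> n"
  shows "simple_refl_C n i = refl_C n (int i)"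
proof
  fix j
  let ?N = "int (2 * n)"
  have low: "wall n (int i) x \<longleftrightarrow> ?N dvd x - int i" if "i = 0 \<or> i = n" for x
  proof -
    have "?N dvd x + int i \<longleftrightarrow> ?N dvd x - int i"
      using that dvd_add_triv_right_iff[of ?N "x - int i"] by (auto simp: algebra_simps)
    then show ?thesis unfolding wall_def by blast
  qed
  have wall_iff: "wall n (int i) x \<longleftrightarrow> ?N dvd x - int i \<or> ?N dvd x - int (2 * n - i)" for x
  proof -
    have "?N dvd x - int (2 * n - i) \<longleftrightarrow> ?N dvd x + int i"
      using dvd_add_triv_right_iff[of ?N "x - int (2 * n - i)"] assms(2)
      by (simp add: of_nat_diff)
    then show ?thesis unfolding wall_def by blast
  qed
  show "simple_refl_C n i j = refl_C n (int i) j"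
  proof (cases "i = 0 \<or> i = n")
    case True
    then show ?thesis
      using low[OF True, of j] low[OF True, of "j - 1"]
      by (simp add: simple_refl_C_def simple_refl_dvd refl_C_def algebra_simps)
  next
    case False
    then have i: "0 < i" "i < n" using assms by auto
    let ?A = "\<lambda>x. ?N dvd x - int i" and ?B = "\<lambda>x. ?N dvd x - int (2 * n - i)"
    have disj: "\<not> (?A x \<and> ?B x)" for x
    proof
      assume "?A x \<and> ?B x"
      then have "?N dvd (x - int i) - (x - int (2 * n - i))" by (simp only: dvd_diff)
      then have "?N dvd int (2 * n - 2 * i)" using i by (simp add: of_nat_diff)
      then have "2 * n dvd 2 * n - 2 * i" unfolding of_nat_dvd_iff .
      then show False using i by (auto dest: dvd_imp_le)
    qed
    have pred: "?A x \<or> ?B x \<Longrightarrow> \<not> (?A (x - 1) \<or> ?B (x - 1))" for x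
      using wall_pred[of n "int i" x] unfolding wall_iff by blast
    have comp: "simple_refl_C n i j = simple_refl (2 * n) i (simple_refl (2 * n) (2 * n - i) j)"
      using False by (simp add: simple_refl_C_def affine_sym_def)
    have s: "simple_refl (2 * n) i x = (if ?A x then x + 1 else if ?A (x - 1) then x - 1 else x)"
      "simple_refl (2 * n) (2 * n - i) x =
        (if ?B x then x + 1 else if ?B (x - 1) then x - 1 else x)" for x
      by (simp_all add: simple_refl_dvd algebra_simps)
    show ?thesis
      unfolding comp s refl_C_def wall_iff
      using pred[of j] pred[of "j + 1"] pred[of "j - 1"] disj[of j] disj[of "j - 1"]
      by (auto simp del: of_nat_mult)
  qed
qed

definition symmetric_affine :: "nat \<Rightarrow> (int \<Rightarrow> int) \<Rightarrow> bool" where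
  "symmetric_affine n w \<longleftrightarrow>
    bij w \<and> (\<forall>j. w (j + int (2 * n)) = w j + int (2 * n)) \<and> (\<forall>j. w (1 - j) = 1 - w j)"

lemma symmetric_affine_id: "symmetric_affine n id"
  by (simp add: symmetric_affine_def)

lemma symmetric_affine_comp:
  "symmetric_affine n v \<Longrightarrow> symmetric_affine n w \<Longrightarrow> symmetric_affine n (v \<circ> w)"
  by (simp add: symmetric_affine_def bij_comp)

lemma symmetric_affine_refl_C: "symmetric_affine n (refl_C n m)"
proof -
  have "bij (refl_C n m)"
    by (rule involuntory_imp_bij) (rule refl_C_involution)
  moreover have "refl_C n m (j + int (2 * n)) = refl_C n m j + int (2 * n)" for j
    using wall_shift[of n m j] wall_shift[of n m "j - 1"] by (simp add: refl_C_def algebra_simps)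
  moreover have "refl_C n m (1 - j) = 1 - refl_C n m j" for j
    using wall_uminus[of n m j] wall_uminus[of n m "j - 1"] wall_pred[of n m j]
    by (auto simp: refl_C_def)
  ultimately show ?thesis by (simp add: symmetric_affine_def)
qed

lemma symmetric_affine_periodic:
  assumes "symmetric_affine n w"
  shows "w (j + int (2 * n) * k) = w j + int (2 * n) * k"
proof -
  have nat: "w (j + int (2 * n) * int l) = w j + int (2 * n) * int l" for j l
  proof (induction l)
    case (Suc l)
    have "w (j + int (2 * n) * int (Suc l)) = w (j + int (2 * n) * int l + int (2 * n))"
      by (simp add: algebra_simps)
    also have "\<dots> = w (j + int (2 * n) * int l) + int (2 * n)"
      using assms unfolding symmetric_affine_def by blast
    also have "\<dots> = w j + int (2 * n) * int (Suc l)"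
      unfolding Suc by (simp add: algebra_simps)
    finally show ?case .
  qed simp
  show ?thesis
  proof (cases "k \<ge> 0")
    case True
    then show ?thesis using nat[of j "nat k"] by simp
  next
    case False
    then show ?thesis
      using nat[of "j + int (2 * n) * k" "nat (- k)"] by (simp add: algebra_simps)
  qed
qed

lemma symmetric_affine_dvd_iff:
  assumes "symmetric_affine n w"
  shows "int (2 * n) dvd w a - w b \<longleftrightarrow> int (2 * n) dvd a - b"
proof
  assume "int (2 * n) dvd a - b"
  then obtain k where "a - b = int (2 * n) * k" by blast
  then have "a = b + int (2 * n) * k" by simp
  then show "int (2 * n) dvd w a - w b"
    using symmetric_affine_periodic[OF assms, of b k] by simp
next
  assume "int (2 * n) dvd w a - w b"
  then obtain k where "w a - w b = int (2 * n) * k" by blast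
  then have "w a = w (b + int (2 * n) * k)"
    using symmetric_affine_periodic[OF assms, of b k] by simp
  then have "a = b + int (2 * n) * k"
    using assms unfolding symmetric_affine_def bij_def inj_def by blast
  then show "int (2 * n) dvd a - b" by simp
qed

text \<open>The usual conjugation rule for transpositions: \<open>u (i i+1) u\<inverse>\<close> exchanges \<open>u i\<close> and \<open>u (i + 1)\<close>,
  and periodicity and symmetry of \<open>u\<close> carry all translates and mirror images along.\<close>

lemma refl_C_conjugate:
  assumes u: "symmetric_affine n u" and adj: "u (i + 1) = u i + 1"
  shows "u \<circ> refl_C n i = refl_C n (u i) \<circ> u"
proof
  fix j
  have mirror: "u (1 - x) = 1 - u x" for x using u by (simp add: symmetric_affine_def)
  have neg: "u (- i) = - u i" using mirror[of "i + 1"] adj by simp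
  have wall: "wall n (u i) (u x) \<longleftrightarrow> wall n i x" for x
    using symmetric_affine_dvd_iff[OF u, of x i] symmetric_affine_dvd_iff[OF u, of x "- i"]
    by (simp add: wall_def neg)
  have step: "u (x + 1) = u x + 1" if x_wall: "wall n i x" for x
  proof -
    obtain k where "x - i = int (2 * n) * k \<or> x + i = int (2 * n) * k"
      using x_wall unfolding wall_def by (blast elim: dvdE)
    then have "x = i + int (2 * n) * k \<or> x = - i + int (2 * n) * k" by linarith
    then show ?thesis
    proof
      assume x: "x = i + int (2 * n) * k"
      have "x + 1 = i + 1 + int (2 * n) * k" using x by simp
      then have "u (x + 1) = u (i + 1 + int (2 * n) * k)" by (rule arg_cong)
      then show ?thesis using x adj by (simp only: symmetric_affine_periodic[OF u])
    next
      assume x: "x = - i + int (2 * n) * k"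
      have "x + 1 = 1 - i + int (2 * n) * k" using x by simp
      then have "u (x + 1) = u (1 - i + int (2 * n) * k)" by (rule arg_cong)
      then show ?thesis
        using x neg mirror[of i] by (simp only: symmetric_affine_periodic[OF u])
    qed
  qed
  have wall': "wall n (u i) (u j - 1) \<longleftrightarrow> wall n i (j - 1)"
  proof
    assume "wall n i (j - 1)"
    then show "wall n (u i) (u j - 1)" using step[of "j - 1"] wall[of "j - 1"] by simp
  next
    assume pred: "wall n (u i) (u j - 1)"
    obtain x where x: "u j - 1 = u x"
      using u unfolding symmetric_affine_def bij_def surj_def by blast
    then have "wall n i x" using pred wall by simp
    then have "u (x + 1) = u j" using step x by simp
    then have "j = x + 1" using u unfolding symmetric_affine_def bij_def inj_def by metis
    then show "wall n i (j - 1)" using \<open>wall n i x\<close> by simp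
  qed
  show "(u \<circ> refl_C n i) j = (refl_C n (u i) \<circ> u) j"
    using wall[of j] wall' step[of j] step[of "j - 1"] by (auto simp: refl_C_def)
qed

text \<open>A generator moves each integer by at most one, so it can only invert the order of two
  neighbours that it exchanges.\<close>

lemma refl_C_swap:
  assumes "p < q" "refl_C n m q < refl_C n m p"
  shows "q = p + 1" "refl_C n m = refl_C n p"
proof -
  have q: "q = p + 1" and wall: "wall n m p"
    using assms wall_pred[of n m q] by (auto simp: refl_C_def split: if_splits)
  show "q = p + 1" by (fact q)
  show "refl_C n m = refl_C n p"
    unfolding refl_C_def wall_base_change[OF wall] ..
qed

section \<open>Words, length and descents\<close>

lemma affine_sym_mult: "v \<otimes>\<^bsub>affine_sym N\<^esub> w = v \<circ> w"
  by (simp add: affine_sym_def)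

lemma affine_sym_one: "\<one>\<^bsub>affine_sym N\<^esub> = id"
  by (simp add: affine_sym_def)

lemma word_prod_Nil: "word_prod (affine_sym N) s [] = id"
  by (simp add: word_prod_def affine_sym_def)

lemma word_prod_Cons: "word_prod (affine_sym N) s (i # is) = s i \<circ> word_prod (affine_sym N) s is"
  by (simp add: word_prod_def affine_sym_def)

lemma word_prod_append:
  "word_prod (affine_sym N) s (is @ js) = word_prod (affine_sym N) s is \<circ> word_prod (affine_sym N) s js"
  by (induction "is") (simp_all add: word_prod_Nil word_prod_Cons comp_assoc)

text \<open>Generators of order two are their own inverses, so that products of generators suffice.\<close>

lemma generate_involutions:
  assumes carrier: "\<And>i. i \<in> I \<Longrightarrow> s i \<in> carrier (affine_sym N)"
    and invol: "\<And>i. i \<in> I \<Longrightarrow> s i \<circ> s i = id"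
  shows "generate (affine_sym N) (s ` I) = word_prod (affine_sym N) s ` {is. set is \<subseteq> I}"
proof
  show "generate (affine_sym N) (s ` I) \<subseteq> word_prod (affine_sym N) s ` {is. set is \<subseteq> I}"
  proof
    fix w assume "w \<in> generate (affine_sym N) (s ` I)"
    then show "w \<in> word_prod (affine_sym N) s ` {is. set is \<subseteq> I}"
    proof induction
      case one
      show ?case
        by (rule image_eqI[of _ _ "[]"]) (simp_all add: word_prod_Nil affine_sym_mult affine_sym_one)
    next
      case (incl h)
      then obtain i where "i \<in> I" "h = s i" by blast
      then show ?case
        by (intro image_eqI[of _ _ "[i]"]) (simp_all add: word_prod_Nil word_prod_Cons)
    next
      case (inv h)
      then obtain i where i: "i \<in> I" "h = s i" by blast
      have "inv\<^bsub>affine_sym N\<^esub> h = h"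
        unfolding m_inv_def
      proof (rule the_equality)
        show "h \<in> carrier (affine_sym N) \<and> h \<otimes>\<^bsub>affine_sym N\<^esub> h = \<one>\<^bsub>affine_sym N\<^esub> \<and>
            h \<otimes>\<^bsub>affine_sym N\<^esub> h = \<one>\<^bsub>affine_sym N\<^esub>"
          using carrier[OF i(1)] invol[OF i(1)] i(2) by (simp add: affine_sym_mult affine_sym_one)
        fix y assume "y \<in> carrier (affine_sym N) \<and> h \<otimes>\<^bsub>affine_sym N\<^esub> y = \<one>\<^bsub>affine_sym N\<^esub> \<and>
            y \<otimes>\<^bsub>affine_sym N\<^esub> h = \<one>\<^bsub>affine_sym N\<^esub>"
        then have "h \<circ> y = id" by (simp add: affine_sym_mult affine_sym_one)
        then have "h \<circ> h \<circ> y = h" by (simp add: comp_assoc)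
        then show "y = h" using invol[OF i(1)] i(2) by simp
      qed
      then show ?case
        using i by (intro image_eqI[of _ _ "[i]"]) (simp_all add: word_prod_Nil word_prod_Cons)
    next
      case (eng v w)
      then obtain js ks where "set js \<subseteq> I" "v = word_prod (affine_sym N) s js"
        "set ks \<subseteq> I" "w = word_prod (affine_sym N) s ks" by blast
      then show ?case
        by (intro image_eqI[of _ _ "js @ ks"]) (simp_all add: word_prod_append affine_sym_mult affine_sym_one)
    qed
  qed
next
  have "word_prod (affine_sym N) s is \<in> generate (affine_sym N) (s ` I)" if "set is \<subseteq> I" for "is"
    using that
  proof (induction "is")
    case Nil
    then show ?case
      using generate.one[of "affine_sym N" "s ` I"]
      unfolding word_prod_Nil affine_sym_one by blast
  next
    case (Cons i "is")
    then have "s i \<in> generate (affine_sym N) (s ` I)" by (intro generate.incl) simp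
    moreover have "word_prod (affine_sym N) s is \<in> generate (affine_sym N) (s ` I)"
      using Cons by simp
    ultimately have "s i \<otimes>\<^bsub>affine_sym N\<^esub> word_prod (affine_sym N) s is
        \<in> generate (affine_sym N) (s ` I)"
      by (rule generate.eng)
    then show ?case unfolding word_prod_Cons affine_sym_mult .
  qed
  then show "word_prod (affine_sym N) s ` {is. set is \<subseteq> I} \<subseteq> generate (affine_sym N) (s ` I)"
    by blast
qed

text \<open>The displacement is \<open>g j - g (j - 1)\<close> for the indicator \<open>g\<close> of the walls, which telescopes to
  zero over a period.\<close>

lemma refl_C_sum: "(\<Sum>j=1..int (2 * n). refl_C n m j) = (\<Sum>j=1..int (2 * n). j)"
proof -
  define g :: "int \<Rightarrow> int" where "g j = of_bool (wall n m j)" for j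
  have diff: "refl_C n m j = j + (g j - g (j - 1))" for j
    using wall_pred[of n m j] by (simp add: refl_C_def g_def)
  have tele: "(\<Sum>j=1..int k. g j - g (j - 1)) = g (int k) - g 0" for k
  proof (induction k)
    case (Suc k)
    have "{1..int (Suc k)} = insert (int (Suc k)) {1..int k}" by auto
    then show ?case using Suc by simp
  qed simp
  have "g (int (2 * n)) = g 0"
    using wall_shift[of n m 0] by (simp add: g_def)
  then show ?thesis
    unfolding diff sum.distrib tele by simp
qed

lemma refl_C_carrier: "refl_C n m \<in> carrier (affine_sym (2 * n))"
  using symmetric_affine_refl_C[of n m] refl_C_sum[of n m]
  by (simp add: affine_sym_def symmetric_affine_def)

abbreviation word_C :: "nat \<Rightarrow> nat list \<Rightarrow> int \<Rightarrow> int" where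
  "word_C n \<equiv> word_prod (affine_sym (2 * n)) (simple_refl_C n)"

lemma generate_C:
  assumes "0 < n" "I \<subseteq> {0..n}"
  shows "generate (affine_sym (2 * n)) (simple_refl_C n ` I) = word_C n ` {is. set is \<subseteq> I}"
proof (rule generate_involutions)
  fix i assume "i \<in> I"
  then have "simple_refl_C n i = refl_C n (int i)" using simple_refl_C_eq assms by auto
  then show "simple_refl_C n i \<in> carrier (affine_sym (2 * n))"
    "simple_refl_C n i \<circ> simple_refl_C n i = id"
    by (auto simp: refl_C_carrier refl_C_involution)
qed

lemma symmetric_affine_word:
  assumes "0 < n" "set is \<subseteq> {0..n}"
  shows "symmetric_affine n (word_C n is)"
  using assms(2)
proof (induction "is")
  case Nil
  show ?case unfolding word_prod_Nil by (rule symmetric_affine_id)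
next
  case (Cons i "is")
  then have "simple_refl_C n i = refl_C n (int i)" "symmetric_affine n (word_C n is)"
    using simple_refl_C_eq[OF assms(1)] by auto
  then show ?case
    unfolding word_prod_Cons by (metis symmetric_affine_comp symmetric_affine_refl_C)
qed

text \<open>The strong exchange argument. Along the suffixes of the word the order of the values at \<open>i\<close>
  and \<open>i + 1\<close> starts increasing and ends decreasing; at the letter that inverts it, these values are
  neighbours exchanged by that letter. Conjugation then turns the letter into \<open>s\<^sub>i\<close> on the
  right, so multiplying by \<open>s\<^sub>i\<close> on the right deletes the letter.\<close>

lemma exchange_at_descent:
  assumes n: "0 < n" and "set is \<subseteq> {0..n}" and "word_C n is (i + 1) < word_C n is i"
  shows "\<exists>js. length js < length is \<and> set js \<subseteq> {0..n} \<and>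
    word_C n js = word_C n is \<circ> refl_C n i"
  using assms(2,3)
proof (induction "is")
  case Nil
  then show ?case by (simp add: word_prod_Nil)
next
  case (Cons a "is")
  let ?u = "word_C n is"
  have a: "simple_refl_C n a = refl_C n (int a)" "a \<le> n" and set: "set is \<subseteq> {0..n}"
    using simple_refl_C_eq[OF n] Cons.prems(1) by auto
  have u: "symmetric_affine n ?u" by (rule symmetric_affine_word[OF n set])
  show ?case
  proof (cases "?u (i + 1) < ?u i")
    case True
    then obtain js where js: "length js < length is" "set js \<subseteq> {0..n}"
      "word_C n js = ?u \<circ> refl_C n i"
      using Cons.IH[OF set] by blast
    then show ?thesis
      using a(2) by (intro exI[of _ "a # js"]) (simp add: word_prod_Cons comp_assoc)
  next
    case False
    moreover have "?u (i + 1) \<noteq> ?u i"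
      using u unfolding symmetric_affine_def bij_def by (auto dest: injD)
    ultimately have less: "?u i < ?u (i + 1)" by simp
    have swap: "refl_C n (int a) (?u (i + 1)) < refl_C n (int a) (?u i)"
      using Cons.prems(2) a(1) by (simp add: word_prod_Cons)
    have "word_C n (a # is) \<circ> refl_C n i = refl_C n (?u i) \<circ> (?u \<circ> refl_C n i)"
      using a(1) refl_C_swap(2)[OF less swap] by (simp add: word_prod_Cons comp_assoc)
    also have "\<dots> = refl_C n (?u i) \<circ> (refl_C n (?u i) \<circ> ?u)"
      using refl_C_conjugate[OF u refl_C_swap(1)[OF less swap]] by simp
    also have "\<dots> = ?u" by (auto simp: refl_C_involution)
    finally show ?thesis using set by (intro exI[of _ "is"]) simp
  qed
qed

lemma weyl_C_words: "0 < n \<Longrightarrow> weyl_C n = word_C n ` {is. set is \<subseteq> {0..n}}"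
  unfolding weyl_C_def by (rule generate_C) auto

lemma finite_weyl_C_words: "0 < n \<Longrightarrow> finite_weyl_C n = word_C n ` {is. set is \<subseteq> {1..n}}"
  unfolding finite_weyl_C_def by (rule generate_C) auto

lemma weyl_C_word:
  assumes "0 < n" "w \<in> weyl_C n"
  obtains "is" where "set is \<subseteq> {0..n}" "w = word_C n is"
  using assms(2) unfolding weyl_C_words[OF assms(1)] by (elim imageE) simp

lemma finite_weyl_C_word:
  assumes "0 < n" "w \<in> finite_weyl_C n"
  obtains "is" where "set is \<subseteq> {1..n}" "w = word_C n is"
  using assms(2) unfolding finite_weyl_C_words[OF assms(1)] by (elim imageE) simp

lemma symmetric_affine_weyl_C:
  assumes "0 < n" "w \<in> weyl_C n"
  shows "symmetric_affine n w"
proof -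
  obtain "is" where word: "set is \<subseteq> {0..n}" "w = word_C n is"
    using weyl_C_word[OF assms] .
  show ?thesis unfolding word(2) by (rule symmetric_affine_word[OF assms(1) word(1)])
qed

lemma length_C_le: "set is \<subseteq> {0..n} \<Longrightarrow> length_C n (word_C n is) \<le> length is"
  unfolding length_C_def by (rule Least_le) (intro exI[of _ "is"] conjI refl)

lemma reduced_word:
  assumes "0 < n" "w \<in> weyl_C n"
  obtains "is" where "length is = length_C n w" "set is \<subseteq> {0..n}" "word_C n is = w"
proof -
  obtain js where "set js \<subseteq> {0..n}" "w = word_C n js"
    using weyl_C_word[OF assms] .
  then have "\<exists>k is. length is = k \<and> set is \<subseteq> {0..n} \<and> word_C n is = w"
    by (intro exI[of _ "length js"] exI[of _ js]) simp
  then have "\<exists>is. length is = length_C n w \<and> set is \<subseteq> {0..n} \<and> word_C n is = w"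
    unfolding length_C_def by (rule LeastI_ex)
  then show ?thesis using that by (elim exE conjE)
qed

lemma length_C_descent:
  assumes "0 < n" "w \<in> weyl_C n" "w (i + 1) < w i"
  shows "length_C n (w \<circ> refl_C n i) < length_C n w"
proof -
  obtain "is" where is_w: "length is = length_C n w" "set is \<subseteq> {0..n}" "word_C n is = w"
    using reduced_word[OF assms(1,2)] .
  then obtain js where "length js < length is" "set js \<subseteq> {0..n}" "word_C n js = w \<circ> refl_C n i"
    using exchange_at_descent[OF assms(1) is_w(2), of i] assms(3) by auto
  then show ?thesis using length_C_le[of js n] is_w(1) by simp
qed

section \<open>Affine Grassmannian elements\<close>

lemma l_coset_affine_sym: "w <#\<^bsub>affine_sym N\<^esub> H = (\<lambda>h. w \<circ> h) ` H"
  by (auto simp: l_coset_def affine_sym_def)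

lemma grassmannian_ascent:
  assumes n: "0 < n" and w: "w \<in> affine_grassmannian_C n" and i: "i \<in> {1..n}"
  shows "w (int i) < w (int i + 1)"
proof (rule ccontr)
  assume not_less: "\<not> ?thesis"
  have weyl: "w \<in> weyl_C n" using w by (simp add: affine_grassmannian_C_def)
  have "w (int i) \<noteq> w (int i + 1)"
    using symmetric_affine_weyl_C[OF n weyl] unfolding symmetric_affine_def bij_def
    by (auto dest: injD)
  then have "length_C n (w \<circ> refl_C n (int i)) < length_C n w"
    using not_less by (intro length_C_descent[OF n weyl]) simp
  moreover have "refl_C n (int i) \<in> finite_weyl_C n"
    unfolding finite_weyl_C_def using i simple_refl_C_eq[OF n, of i]
    by (intro generate.incl image_eqI[of _ _ i]) simp_all
  ultimately show False
    using w by (force simp: affine_grassmannian_C_def l_coset_affine_sym)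
qed

text \<open>The second half of the window is the mirror image of the first under
  \<open>j \<mapsto> 2n + 1 - j\<close>, with which \<open>w\<close> commutes.\<close>

lemma grassmannian_window_ascent:
  assumes n: "0 < n" and w: "w \<in> affine_grassmannian_C n" and i: "1 \<le> i" "i < int (2 * n)"
  shows "w i < w (i + 1)"
proof (cases "i \<le> int n")
  case True
  then have "nat i \<in> {1..n}" using i by (simp add: le_nat_iff nat_le_iff)
  then show ?thesis using grassmannian_ascent[OF n w, of "nat i"] i by simp
next
  case False
  define k where "k = int (2 * n) - i"
  have sym: "symmetric_affine n w"
    using w n symmetric_affine_weyl_C by (simp add: affine_grassmannian_C_def)
  have mirror: "w (int (2 * n) + 1 - j) = int (2 * n) + 1 - w j" for j
  proof -
    have "w (1 - j + int (2 * n)) = w (1 - j) + int (2 * n)"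
      using sym unfolding symmetric_affine_def by blast
    also have "w (1 - j) = 1 - w j" using sym unfolding symmetric_affine_def by blast
    finally show ?thesis by (simp add: algebra_simps)
  qed
  have "nat k \<in> {1..n}" using False i by (simp add: k_def le_nat_iff nat_le_iff)
  then have "w k < w (k + 1)"
    using grassmannian_ascent[OF n w, of "nat k"] i by (simp add: k_def)
  then show ?thesis
    using mirror[of k] mirror[of "k + 1"] by (simp add: k_def add.commute[of 1 i])
qed

lemma grassmannian_window_sorted:
  assumes "0 < n" "w \<in> affine_grassmannian_C n"
  shows "sorted_wrt (<) (map w [1..int (2 * n)])"
proof -
  have mono: "w i < w (i + 1 + int k)" if "1 \<le> i" "i + int k < int (2 * n)" for i k
    using that
  proof (induction k)
    case 0
    then show ?case using grassmannian_window_ascent[OF assms, of i] by simp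
  next
    case (Suc k)
    then have "w i < w (i + 1 + int k)" by simp
    also have "\<dots> < w (i + 1 + int k + 1)"
      using grassmannian_window_ascent[OF assms, of "i + 1 + int k"] Suc.prems by simp
    finally show ?case by (simp add: algebra_simps)
  qed
  have "sorted_wrt (\<lambda>i j. w i < w j) [1..int (2 * n)]"
  proof (rule sorted_wrt_mono_rel[OF _ sorted_wrt_upto])
    fix i j assume "i \<in> set [1..int (2 * n)]" "j \<in> set [1..int (2 * n)]" "i < j"
    then show "w i < w j" using mono[of i "nat (j - i - 1)"] by simp
  qed
  then show ?thesis by (simp add: sorted_wrt_map)
qed

lemma symmetric_affine_window_image:
  assumes "symmetric_affine n w"
  shows "w ` {1..int (2 * n)} = (\<lambda>x. x + int (2 * n)) ` w ` {..0} - w ` {..0}"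
proof -
  have inj: "inj w" and shift: "w j + int (2 * n) = w (j + int (2 * n))" for j
    using assms by (simp_all add: symmetric_affine_def bij_def)
  have "(\<lambda>x. x + int (2 * n)) ` w ` {..0} = w ` (\<lambda>x. x + int (2 * n)) ` {..0}"
    unfolding image_image shift ..
  also have "(\<lambda>x. x + int (2 * n)) ` {..0} = {..int (2 * n)}"
    by (auto intro: image_eqI[of _ _ "x - int (2 * n)" for x])
  finally have "(\<lambda>x. x + int (2 * n)) ` w ` {..0} - w ` {..0} = w ` ({..int (2 * n)} - {..0})"
    using image_set_diff[OF inj] by simp
  also have "{..int (2 * n)} - {..0} = {1..int (2 * n)}" by auto
  finally show ?thesis ..
qed

lemma grassmannian_determined:
  assumes n: "0 < n" and v: "v \<in> affine_grassmannian_C n" and w: "w \<in> affine_grassmannian_C n"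
    and eq: "v ` {..0} = w ` {..0}"
  shows "v = w"
proof
  fix j
  have sym: "symmetric_affine n v" "symmetric_affine n w"
    using v w n symmetric_affine_weyl_C by (simp_all add: affine_grassmannian_C_def)
  have "set (map v [1..int (2 * n)]) = set (map w [1..int (2 * n)])"
    using symmetric_affine_window_image[OF sym(1)] symmetric_affine_window_image[OF sym(2)] eq
    by simp
  then have "map v [1..int (2 * n)] = map w [1..int (2 * n)]"
    using grassmannian_window_sorted[OF n] v w strict_sorted_equal by blast
  then have window: "v i = w i" if "i \<in> {1..int (2 * n)}" for i using that by simp
  define k where "k = (j - 1) div int (2 * n)"
  define i where "i = (j - 1) mod int (2 * n) + 1"
  have "i \<in> {1..int (2 * n)}"
    using n pos_mod_bound[of "int (2 * n)" "j - 1"] pos_mod_sign[of "int (2 * n)" "j - 1"]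
    unfolding i_def atLeastAtMost_iff by linarith
  moreover have "j = i + int (2 * n) * k"
    unfolding i_def k_def using mult_div_mod_eq[of "int (2 * n)" "j - 1"] by linarith
  ultimately show "v j = w j"
    using symmetric_affine_periodic[OF sym(1), of i k] symmetric_affine_periodic[OF sym(2), of i k]
      window by simp
qed

text \<open>The only pair of neighbours that could leak out of \<open>{..0}\<close> is \<open>(0, 1)\<close>, and it is exchanged only by
  the generator with index 0.\<close>

lemma finite_weyl_C_stabilizes:
  assumes n: "0 < n" and "h \<in> finite_weyl_C n"
  shows "h ` {..0} = {..0}"
proof -
  obtain "is" where word: "set is \<subseteq> {1..n}" "h = word_C n is"
    using finite_weyl_C_word[OF assms] .
  have "word_C n is ` {..0} = {..0}" using word(1)
  proof (induction "is")
    case Nil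
    show ?case by (simp add: word_prod_Nil)
  next
    case (Cons i "is")
    then have i: "1 \<le> i" "i \<le> n" by auto
    have "\<not> wall n (int i) 0"
    proof
      assume "wall n (int i) 0"
      then have "2 * n dvd i" 
        using of_nat_dvd_iff[where 'a = int, of "2 * n" i] by (simp add: wall_def)
      then show False using i by (auto dest: dvd_imp_le)
    qed
    then have le: "refl_C n (int i) j \<le> 0" if "j \<le> 0" for j
      using that by (cases "j = 0") (auto simp: refl_C_def)
    have "refl_C n (int i) ` {..0} = {..0}"
    proof
      show "{..0} \<subseteq> refl_C n (int i) ` {..0}"
      proof
        fix x :: int assume "x \<in> {..0}"
        then show "x \<in> refl_C n (int i) ` {..0}"
          using le[of x] refl_C_involution[of n "int i" x]
          by (intro image_eqI[of _ _ "refl_C n (int i) x"]) simp_all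
      qed
    qed (use le in auto)
    moreover have "word_C n is ` {..0} = {..0}" using Cons by simp
    ultimately show ?case
      unfolding word_prod_Cons simple_refl_C_eq[OF n i(2)] by (simp only: image_comp[symmetric])
  qed
  then show ?thesis using word(2) by simp
qed

lemma grassmannian_representative:
  assumes n: "0 < n" and w: "w \<in> weyl_C n"
  obtains v where "v \<in> affine_grassmannian_C n" "v ` {..0} = w ` {..0}"
proof -
  let ?H = "finite_weyl_C n"
  have id: "id \<in> ?H"
    using generate.one[of "affine_sym (2 * n)" "simple_refl_C n ` {1..n}"]
    unfolding finite_weyl_C_def affine_sym_one by blast
  obtain h where h: "h \<in> ?H" "\<And>g. g \<in> ?H \<Longrightarrow> length_C n (w \<circ> h) \<le> length_C n (w \<circ> g)"
    using ex_has_least_nat[of "\<lambda>h. h \<in> ?H" id "\<lambda>h. length_C n (w \<circ> h)"] id by blast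
  have comp: "h \<circ> g \<in> ?H" if "g \<in> ?H" for g
    using generate.eng[of h "affine_sym (2 * n)" "simple_refl_C n ` {1..n}" g] h(1) that
    by (simp add: finite_weyl_C_def affine_sym_mult affine_sym_one)
  obtain js where "set js \<subseteq> {1..n}" "h = word_C n js"
    using finite_weyl_C_word[OF n h(1)] .
  then have "h \<in> weyl_C n"
    unfolding weyl_C_words[OF n] by (intro image_eqI[of _ _ js]) auto
  then have "w \<circ> h \<in> weyl_C n"
    using generate.eng[of w "affine_sym (2 * n)" "simple_refl_C n ` {0..n}" h] w
    by (simp add: weyl_C_def affine_sym_mult affine_sym_one)
  then have "w \<circ> h \<in> affine_grassmannian_C n"
    using h comp by (auto simp: affine_grassmannian_C_def l_coset_affine_sym comp_assoc)
  moreover have "(w \<circ> h) ` {..0} = w ` {..0}"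
    using finite_weyl_C_stabilizes[OF n h(1)] by (simp only: image_comp[symmetric])
  ultimately show ?thesis using that by blast
qed

section \<open>The orbit of the empty core\<close>

text \<open>A type C generator as a word in the generators of the affine symmetric group. The index \<open>2n - i\<close>
  stands for the residue \<open>-i\<close>.\<close>

definition letters :: "nat \<Rightarrow> nat \<Rightarrow> nat list" where
  "letters n i = (if i = 0 \<or> i = n then [i] else [i, 2 * n - i])"

lemma letters_less: "0 < n \<Longrightarrow> i \<le> n \<Longrightarrow> set (letters n i) \<subseteq> {..<2 * n}"
  by (auto simp: letters_def)

lemma word_prod_letters:
  "word_prod (affine_sym (2 * n)) (simple_refl (2 * n)) (letters n i) = simple_refl_C n i"
  by (simp add: letters_def word_prod_Nil word_prod_Cons simple_refl_C_def affine_sym_mult)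

lemma word_prod_concat_letters:
  "word_prod (affine_sym (2 * n)) (simple_refl (2 * n)) (concat (map (letters n) is)) = word_C n is"
  by (induction "is")
    (simp_all add: word_prod_Nil word_prod_Cons word_prod_append word_prod_letters)

lemma empty_core: "{} \<in> cores N"
  by (simp add: cores_def young_diagram_empty)

lemma core_act_weyl_C:
  assumes n: "0 < n" and w: "w \<in> weyl_C n"
  shows "core_act (2 * n) w {} \<in> cores (2 * n)" "beta (core_act (2 * n) w {}) = w ` {..0}"
proof -
  obtain "is" where word: "set is \<subseteq> {0..n}" "w = word_C n is"
    using weyl_C_word[OF assms] .
  let ?js = "concat (map (letters n) is)"
  have js: "set ?js \<subseteq> {..<2 * n}" using letters_less[OF n] word(1) by fastforce
  have act: "core_act (2 * n) w {} = foldr (reflect_core (2 * n)) ?js {}"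
    using core_act_word[OF _ js empty_core] n word(2) word_prod_concat_letters by simp
  show "core_act (2 * n) w {} \<in> cores (2 * n)" "beta (core_act (2 * n) w {}) = w ` {..0}"
    unfolding act using foldr_reflect_core[OF _ js empty_core] n word(2)
    by (simp_all add: word_prod_concat_letters beta_empty)
qed

lemma symmetric_affine_image_beta:
  assumes "symmetric_affine n w" "\<And>m. m \<in> B \<longleftrightarrow> 1 - m \<notin> B"
  shows "m \<in> w ` B \<longleftrightarrow> 1 - m \<notin> w ` B"
proof -
  obtain j where j: "m = w j"
    using assms(1) unfolding symmetric_affine_def bij_def surj_def by blast
  have "inj w" "1 - m = w (1 - j)"
    using assms(1) j by (simp_all add: symmetric_affine_def bij_def)
  then show ?thesis using j assms(2)[of j] by (simp add: inj_image_mem_iff)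
qed

lemma self_conjugate_cores_iff:
  "D \<in> self_conjugate_cores N \<longleftrightarrow> D \<in> cores N \<and> (\<forall>m. m \<in> beta D \<longleftrightarrow> 1 - m \<notin> beta D)"
  using self_conjugate_iff_beta by (auto simp: self_conjugate_cores_def cores_def)

text \<open>Take a box with the largest sum of coordinates.\<close>

lemma removable_node_exists:
  assumes "young_diagram D" "D \<noteq> {}"
  obtains b where "b \<in> D" "young_diagram (D - {b})"
proof -
  let ?f = "\<lambda>(i, j). i + j :: nat"
  have fin: "finite D" using finite_young_diagram[OF assms(1)] .
  then have "Max (?f ` D) \<in> ?f ` D" using assms(2) by (intro Max_in) auto
  then obtain b where b: "b \<in> D" "?f b = Max (?f ` D)" by auto
  have max: "?f x \<le> ?f b" if "x \<in> D" for x
    using fin that b(2) by simp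
  have "young_diagram (D - {b})"
  proof (rule young_diagramI)
    fix i j i' j' assume ij: "(i, j) \<in> D - {b}" "i' \<le> i" "j' \<le> j"
    have "(i', j') \<in> D" using young_diagram_down[OF assms(1)] ij by blast
    moreover have "(i', j') \<noteq> b" using max[of "(i, j)"] ij by auto
    ultimately show "(i', j') \<in> D - {b}" by simp
  qed (use fin in simp)
  then show ?thesis using b(1) that by blast
qed

lemma reflect_core_removable:
  assumes "young_diagram D" "b \<in> removable_nodes N i D"
  shows "reflect_core N i D = D - removable_nodes N i D" "card (reflect_core N i D) < card D"
proof -
  show eq: "reflect_core N i D = D - removable_nodes N i D"
    using assms(2) by (auto simp: reflect_core_def)
  have "b \<in> D" using assms(2) by (simp add: removable_nodes_def)
  then show "card (reflect_core N i D) < card D"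
    unfolding eq using assms finite_young_diagram by (intro psubset_card_mono) auto
qed

text \<open>By self-conjugacy a removable node of residue \<open>i\<close> comes with a mirror-image node of residue
  \<open>-i\<close>. If \<open>0 < i < n\<close> then both letters remove nodes: taking away the nodes of one residue leaves a node of
  another residue removable, since intersections of Young diagrams are Young diagrams.\<close>

lemma reflect_letters_shrinks:
  assumes n: "0 < n" and i: "i \<le> n" and D: "D \<in> self_conjugate_cores (2 * n)"
    and b: "b \<in> removable_nodes (2 * n) i D"
  shows "card (foldr (reflect_core (2 * n)) (letters n i) D) < card D"
proof (cases "i = 0 \<or> i = n")
  case True
  have "young_diagram D" using D by (simp add: self_conjugate_cores_def cores_def)
  then show ?thesis
    using reflect_core_removable(2)[OF _ b] True by (auto simp: letters_def)
next
  case False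
  then have i': "0 < i" "i < n" using i by auto
  have young: "young_diagram D" and conj: "D\<inverse> = D"
    using D by (simp_all add: self_conjugate_cores_def cores_def)
  obtain p q where pq: "b = (p, q)" by (cases b)
  have bD: "(p, q) \<in> D" "young_diagram (D - {(p, q)})"
    and res: "(int q - int p) mod int (2 * n) = int i"
    using b pq by (simp_all add: removable_nodes_def residue_def)
  have "(q, p) \<in> D" using bD(1) conj by blast
  moreover have "(D - {(p, q)})\<inverse> = D\<inverse> - {(q, p)}" by auto
  then have "young_diagram (D - {(q, p)})" using young_diagram_converse[OF bD(2)] conj by simp
  moreover have "(int p - int q) mod int (2 * n) = int (2 * n - i)"
    using zmod_zminus1_eq_if[of "int q - int p" "int (2 * n)"] res i' by (simp add: of_nat_diff)
  ultimately have mirror: "(q, p) \<in> removable_nodes (2 * n) (2 * n - i) D"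
    by (simp add: removable_nodes_def residue_def)
  let ?E = "reflect_core (2 * n) (2 * n - i) D"
  have E: "?E = D - removable_nodes (2 * n) (2 * n - i) D" "card ?E < card D"
    using reflect_core_removable[OF young mirror] .
  have youngE: "young_diagram ?E" unfolding E(1) by (rule young_diagram_remove[OF young])
  have "(p, q) \<notin> removable_nodes (2 * n) (2 * n - i) D"
    using res i' by (auto simp: removable_nodes_def residue_def)
  then have "(p, q) \<in> ?E" using E(1) bD(1) by simp
  moreover have "young_diagram (?E - {(p, q)})"
  proof (rule young_diagramI)
    fix k l k' l' assume kl: "(k, l) \<in> ?E - {(p, q)}" "k' \<le> k" "l' \<le> l"
    have "(k', l') \<in> ?E" using young_diagram_down[OF youngE _ kl(2,3)] kl(1) by blast
    moreover have "(k, l) \<in> D - {(p, q)}" using kl(1) E(1) by blast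
    then have "(k', l') \<in> D - {(p, q)}" using young_diagram_down[OF bD(2) _ kl(2,3)] by blast
    ultimately show "(k', l') \<in> ?E - {(p, q)}" by blast
  qed (use finite_young_diagram[OF youngE] in simp)
  ultimately have "(p, q) \<in> removable_nodes (2 * n) i ?E"
    using res by (simp add: removable_nodes_def residue_def)
  then have "card (reflect_core (2 * n) i ?E) < card ?E"
    by (rule reflect_core_removable(2)[OF youngE])
  then show ?thesis using E(2) False by (simp add: letters_def)
qed

lemma self_conjugate_removable_node:
  assumes n: "0 < n" and D: "D \<in> self_conjugate_cores (2 * n)" "D \<noteq> {}"
  obtains i b where "i \<le> n" "b \<in> removable_nodes (2 * n) i D"
proof -
  have young: "young_diagram D" and conj: "D\<inverse> = D"
    using D by (simp_all add: self_conjugate_cores_def cores_def)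
  obtain p q where pq: "(p, q) \<in> D" "young_diagram (D - {(p, q)})"
    using removable_node_exists[OF young D(2)] by (metis surj_pair)
  have qp: "(q, p) \<in> D" "young_diagram (D - {(q, p)})"
  proof -
    show "(q, p) \<in> D" using pq(1) conj by blast
    have "(D - {(p, q)})\<inverse> = D\<inverse> - {(q, p)}" by auto
    then show "young_diagram (D - {(q, p)})" using young_diagram_converse[OF pq(2)] conj by simp
  qed
  define r where "r = (int q - int p) mod int (2 * n)"
  have r: "0 \<le> r" "r < int (2 * n)" using n by (simp_all add: r_def)
  show ?thesis
  proof (cases "r \<le> int n")
    case True
    then have "(p, q) \<in> removable_nodes (2 * n) (nat r) D"
      using pq r by (simp add: removable_nodes_def residue_def r_def)
    then show ?thesis using that[of "nat r"] True by simp
  next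
    case False
    then have "(int p - int q) mod int (2 * n) = int (2 * n) - r"
      using zmod_zminus1_eq_if[of "int q - int p" "int (2 * n)"] n by (simp add: r_def)
    then have "(q, p) \<in> removable_nodes (2 * n) (nat (int (2 * n) - r)) D"
      using qp r by (simp add: removable_nodes_def residue_def)
    then show ?thesis using that[of "nat (int (2 * n) - r)"] False by simp
  qed
qed

lemma self_conjugate_core_reached:
  assumes n: "0 < n" and "D \<in> self_conjugate_cores (2 * n)"
  shows "\<exists>is. set is \<subseteq> {0..n} \<and> beta D = word_C n is ` {..0}"
  using assms(2)
proof (induction "card D" arbitrary: D rule: less_induct)
  case less
  show ?case
  proof (cases "D = {}")
    case True
    then show ?thesis by (intro exI[of _ "[]"]) (simp add: beta_empty word_prod_Nil)
  next
    case False
    then obtain i b where i: "i \<le> n" and b: "b \<in> removable_nodes (2 * n) i D"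
      using self_conjugate_removable_node[OF n less.prems] by blast
    let ?E = "foldr (reflect_core (2 * n)) (letters n i) D"
    have core: "D \<in> cores (2 * n)" and sym: "\<And>m. m \<in> beta D \<longleftrightarrow> 1 - m \<notin> beta D"
      using less.prems self_conjugate_cores_iff by blast+
    have E: "?E \<in> cores (2 * n)" "beta ?E = refl_C n (int i) ` beta D"
      using foldr_reflect_core[OF _ letters_less[OF n i] core] n
        word_prod_letters simple_refl_C_eq[OF n i] by simp_all
    then have "?E \<in> self_conjugate_cores (2 * n)"
      unfolding self_conjugate_cores_iff E(2)
      using symmetric_affine_image_beta[OF symmetric_affine_refl_C sym] by (intro conjI allI)
    then obtain "is" where word: "set is \<subseteq> {0..n}" "beta ?E = word_C n is ` {..0}"
      using less.hyps[OF reflect_letters_shrinks[OF n i less.prems b]] by blast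
    have "beta D = refl_C n (int i) ` beta ?E"
      unfolding E(2) by (simp add: image_image refl_C_involution)
    also have "\<dots> = word_C n (i # is) ` {..0}"
      using word(2) simple_refl_C_eq[OF n i] by (simp add: word_prod_Cons image_comp)
    finally show ?thesis using word(1) i by (intro exI[of _ "i # is"]) simp
  qed
qed

theorem lemma5p3:
  fixes n :: nat
  assumes "n \<ge> 2"
  shows "(\<lambda>w. core_act (2 * n) w {}) ` weyl_C n = self_conjugate_cores (2 * n) \<and>
    bij_betw (\<lambda>w. core_act (2 * n) w {}) (affine_grassmannian_C n) (self_conjugate_cores (2 * n))"
proof
  let ?act = "\<lambda>w. core_act (2 * n) w {}"
  have n: "0 < n" using assms by simp
  have subset: "affine_grassmannian_C n \<subseteq> weyl_C n" by (auto simp: affine_grassmannian_C_def)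
  have into: "?act w \<in> self_conjugate_cores (2 * n)" if "w \<in> weyl_C n" for w
  proof -
    have "m \<in> w ` {..0} \<longleftrightarrow> 1 - m \<notin> w ` {..0}" for m
      by (rule symmetric_affine_image_beta[OF symmetric_affine_weyl_C[OF n that]]) auto
    then show ?thesis
      using core_act_weyl_C(1)[OF n that]
      unfolding self_conjugate_cores_iff core_act_weyl_C(2)[OF n that] by (intro conjI allI)
  qed
  have onto: "\<exists>w\<in>weyl_C n. beta D = w ` {..0}" if D: "D \<in> self_conjugate_cores (2 * n)" for D
  proof -
    obtain "is" where word: "set is \<subseteq> {0..n}" "beta D = word_C n is ` {..0}"
      using self_conjugate_core_reached[OF n D] by (elim exE conjE)
    then show ?thesis unfolding weyl_C_words[OF n] by (intro bexI[of _ "word_C n is"]) simp_all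
  qed
  have eqI: "D = ?act w"
    if "D \<in> self_conjugate_cores (2 * n)" "w \<in> weyl_C n" "beta D = w ` {..0}" for D w
    using that core_act_weyl_C[OF n that(2)]
    by (intro beta_inject) (simp_all add: self_conjugate_cores_def cores_def)
  show "?act ` weyl_C n = self_conjugate_cores (2 * n)"
    using into onto eqI by blast
  show "bij_betw ?act (affine_grassmannian_C n) (self_conjugate_cores (2 * n))"
  proof (rule bij_betwI')
    fix v w assume vw: "v \<in> affine_grassmannian_C n" "w \<in> affine_grassmannian_C n"
    then have "v \<in> weyl_C n" "w \<in> weyl_C n" using subset by auto
    then have "v ` {..0} = w ` {..0}" if "?act v = ?act w"
      using core_act_weyl_C(2)[OF n] that by metis
    then show "?act v = ?act w \<longleftrightarrow> v = w" using grassmannian_determined[OF n vw] by blast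
  next
    fix D assume D: "D \<in> self_conjugate_cores (2 * n)"
    then obtain w where w: "w \<in> weyl_C n" "beta D = w ` {..0}" using onto by blast
    obtain v where v: "v \<in> affine_grassmannian_C n" "v ` {..0} = w ` {..0}"
      using grassmannian_representative[OF n w(1)] .
    then have "D = ?act v" using eqI[OF D, of v] subset w(2) by auto
    then show "\<exists>v\<in>affine_grassmannian_C n. D = ?act v" using v(1) by blast
  qed (use into subset in blast)
qed

end
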